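(* Let $(V,E,\Psi)$ be a strongly connected planar box-like self-affine GIFS satisfying the rectangular open set condition (ROSC) and such that all $T_e$ ($e\in E$) are diagonal, let $\mathcal P=(p_e)_{e\in E}$ be an associated positive vector, $\{\mu_v\}_{v\in V}$ the associated graph-directed box-like self-affine measure family, and $\gamma$ the function defined by $P(\gamma(q),q)=1$, with $P$ the pressure function. Then for every $q\ge0$, either $$\text{(i)}\quad \max\{\gamma_A(q),\gamma_B(q)\}\le t(q)\qquad\text{or}\qquad\text{(ii)}\quad \min\{\gamma_A(q),\gamma_B(q)\}\ge t(q).$$ (a) If (i) holds, $$\begin{aligned}\gamma(q)&=\max\{\gamma_A(q),\gamma_B(q)\}\\&=\max\{x+y:\rho(F^{(q)}_{x,y})=1,\ \gamma_B(q)-\tau_B(q)\le x\le\tau_A(q)\}\\&=\max\{x+y:\rho(F^{(q)}_{x,y})=1,\ \gamma_A(q)-\tau_A(q)\le y\le\tau_B(q)\}.\end{aligned}$$ (b) If (ii) holds, $$\begin{aligned}\gamma(q)&=\min\{x+y:\rho(F^{(q)}_{x,y})=1,\ \tau_A(q)\le x\le\gamma_B(q)-\tau_B(q)\}\\&=\min\{x+y:\rho(F^{(q)}_{x,y})=1,\ \tau_B(q)\le y\le\gamma_A(q)-\tau_A(q)\}.\end{aligned}$$ Moreover (in case (ii)): (b1) if $\sum_{e\in E}f^{(q)}_e(\tau_A(q))\log(a_e/b_e)\ge0$, then $\gamma(q)=\gamma_A(q)$; (b2) if $\sum_{e\in E}f^{(q)}_e(\gamma_B(q)-\tau_B(q))\log(a_e/b_e)\le0$,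 then $\gamma(q)=\gamma_B(q)$; (b3) otherwise, there exist $x\in[\tau_A(q),\gamma_B(q)-\tau_B(q)]$ and $y\in[\tau_B(q),\gamma_A(q)-\tau_A(q)]$ with $\rho(F^{(q)}_{x,y})=1$ satisfying $\sum_{e\in E}f^{(q)}_e(x)\log(a_e/b_e)=0$ and $\gamma(q)=x+y$.
   Context: Graph: $(V,E)$ is a finite directed graph (loops and multiple edges allowed) in which every vertex is the initial vertex of at least one edge; $i(e),t(e)$ are the initial and terminal vertices of $e\in E$. $E^k$ ($k\ge1$) is the set of words $w=w_1\cdots w_k$ of edges with $t(w_{j-1})=i(w_j)$ for $1<j\le k$; $E^*=\bigcup_{k\ge1}E^k$; $i(w)=i(w_1)$, $t(w)=t(w_k)$; $v\xrightarrow{w}v'$ means $i(w)=v,t(w)=v'$. Strongly connected: for all $v,v'\in V$ there is $w\in E^*$ with $v\xrightarrow{w}v'$. The planar box-like self-affine GIFS $(V,E,\Psi)$ with all $T_e$ diagonal consists of such a graph and maps $\psi_e(\xi)=T_e\xi+t_e$ on $\mathbb R^2$, $t_e\in\mathbb R^2$, $T_e=\begin{pmatrix}\pm a_e&0\\0&\pm b_e\end{pmatrix}$, $0<a_e,b_e<1$. ROSC: for every $v\in V$, the sets $\psi_e((0,1)^2)$ with $i(e)=v$ are pairwise disjoint subsets of $(0,1)^2$. $\{X_v\}_{v\in V}$ is the unique family of non-empty compact sets with $X_v=\bigcup_{e:\,i(e)=v}\psi_e(X_{t(e)})$. An associated positive vector: $p_e>0$, $\sum_{e:\,i(e)=v}p_e=1$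 for all $v$. $\{\mu_v\}$ is the unique family of Borel probability measures, $\mu_v$ supported on $X_v$, with $\mu_v=\sum_{e:\,i(e)=v}p_e\,\mu_{t(e)}\circ\psi_e^{-1}$. $\mu_v^x,\mu_v^y$ are the projections of $\mu_v$ to the $x$- and $y$-axis. $L^q$-spectrum: for a compactly supported Borel probability measure $\nu$ on $\mathbb R^n$, $q\ge0$, $\mathcal D^q_\delta(\nu)=\sum_Q\nu(Q)^q$ over closed cubes $Q$ of the $\delta$-mesh (for $q=0$, the number of cubes with $\nu(Q)>0$), and $\tau_\nu(q)=\lim_{\delta\to0+}\frac{\log\mathcal D^q_\delta(\nu)}{-\log\delta}$. In this setting $\tau_{\mu_v^x}(q)$ and $\tau_{\mu_v^y}(q)$ exist and do not depend on $v$; put $\tau_A(q)=\tau_{\mu_v^x}(q)$, $\tau_B(q)=\tau_{\mu_v^y}(q)$, $t(q)=\tau_A(q)+\tau_B(q)$. Pressure function: for $w=w_1\cdots w_k\in E^*$, let $p_w=\prod p_{w_j}$, $a_w=\prod a_{w_j}$, $b_w=\prod b_{w_j}$, $\alpha_1(w)=\max\{a_w,b_w\}$, $\alpha_2(w)=\min\{a_w,b_w\}$, $\tau_w(q)=\tau_A(q)$ if $a_w\ge b_w$ and $\tau_w(q)=\tau_B(q)$ if $a_w<b_w$. For $s\in\mathbb R$, $q\ge0$ let $\varphi^{s,q}(w)=p_w^q\alpha_1(w)^{\tau_w(q)}\alpha_2(w)^{s-\tau_w(q)}$, $A_k^{s,q}(v,v')=\sum_{w\in E^k:\,v\xrightarrow{w}v'}\varphi^{s,q}(w)$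 (a $\#V\times\#V$ matrix), $P(s,q)=\lim_{k\to\infty}\|A_k^{s,q}\|^{1/k}$ ($\|\cdot\|$ = sum of absolute values of entries). The limit exists and for each $q\ge0$ there is a unique $s=\gamma(q)$ with $P(s,q)=1$. Matrices: $\rho(\cdot)$ is the spectral radius. For $q\ge0$, $x,y\in\mathbb R$, $F^{(q)}_{x,y}$ is the $\#E\times\#E$ matrix with $F^{(q)}_{x,y}(e,e')=p_{e'}^q a_{e'}^x b_{e'}^y$ if $t(e)=i(e')$ and $0$ otherwise. For fixed $q$ and one of $x,y$ fixed there is a unique value of the other with $\rho(F^{(q)}_{x,y})=1$. $\gamma_A(q),\gamma_B(q)$ are the unique solutions of $\rho(F^{(q)}_{\tau_A(q),\,\gamma_A(q)-\tau_A(q)})=1$ and $\rho(F^{(q)}_{\gamma_B(q)-\tau_B(q),\,\tau_B(q)})=1$. For fixed $q$ let $y(x)$ be defined by $\rho(F^{(q)}_{x,y(x)})=1$; let $u(x)=(u_e(x))_{e\in E}$ be the unique positive unit column vector with $F^{(q)}_{x,y(x)}u(x)=u(x)$ (right Perron vector) and $v(x)=(v_e(x))_{e\in E}$ the unique positive row vector with $v(x)F^{(q)}_{x,y(x)}=v(x)$ and $\sum_{e}v_e(x)u_e(x)=1$. Then $f^{(q)}_e(x)=v_e(x)u_e(x)$, $e\in E$. *)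

theory Defs
  imports "HOL-Analysis.Analysis" "HOL-Probability.Probability"
begin

section \<open>Spectral radius and Perron vectors\<close>

text \<open>Eigenvalues are complex also for a real matrix. The set of eigenvalues is finite and
  non-empty, so that Max is meaningful.\<close>

definition eigenvalues :: "real^'n^'n \<Rightarrow> complex set" where
  "eigenvalues M = {z. \<exists>v::complex^'n. v \<noteq> 0 \<and> (\<chi> i j. complex_of_real (M $ i $ j)) *v v = z *s v}"

definition spectral_radius :: "real^'n^'n \<Rightarrow> real" where
  "spectral_radius M = Max (cmod ` eigenvalues M)"

definition right_perron_vector :: "real^'n^'n \<Rightarrow> real^'n" where
  "right_perron_vector M = (THE u. (\<forall>i. u $ i > 0) \<and> norm u = 1 \<and> M *v u = u)"

definition left_perron_vector :: "real^'n^'n \<Rightarrow> real^'n" where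
  "left_perron_vector M = (THE v. (\<forall>i. v $ i > 0) \<and> v v* M = v \<and>
     (\<Sum>i\<in>UNIV. v $ i * right_perron_vector M $ i) = 1)"

section \<open>Maxima and minima of possibly infinite sets of reals\<close>

definition is_maximum :: "real set \<Rightarrow> real \<Rightarrow> bool" where
  "is_maximum S m \<longleftrightarrow> m \<in> S \<and> (\<forall>z\<in>S. z \<le> m)"

definition is_minimum :: "real set \<Rightarrow> real \<Rightarrow> bool" where
  "is_minimum S m \<longleftrightarrow> m \<in> S \<and> (\<forall>z\<in>S. m \<le> z)"

section \<open>The \<open>L\<^sup>q\<close>-spectrum of a measure\<close>

definition mesh :: "real \<Rightarrow> 'a::euclidean_space set set" where
  "mesh \<delta> = {cbox (\<delta> *\<^sub>R k) (\<delta> *\<^sub>R (k + One)) | k. \<forall>b\<in>Basis. k \<bullet> b \<in> \<int>}"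

text \<open>Only cubes of positive measure are summed; for a compactly supported measure there are
  finitely many of them. For \<open>q = 0\<close> this is their number.\<close>

definition moment_sum :: "'a::euclidean_space measure \<Rightarrow> real \<Rightarrow> real \<Rightarrow> real" where
  "moment_sum \<nu> q \<delta> = (\<Sum>Q\<in>{Q\<in>mesh \<delta>. measure \<nu> Q > 0}. measure \<nu> Q powr q)"

definition has_Lq_spectrum :: "'a::euclidean_space measure \<Rightarrow> real \<Rightarrow> real \<Rightarrow> bool" where
  "has_Lq_spectrum \<nu> q \<tau> \<longleftrightarrow> ((\<lambda>\<delta>. ln (moment_sum \<nu> q \<delta>) / (- ln \<delta>)) \<longlongrightarrow> \<tau>) (at_right 0)"

section \<open>Planar box-like self-affine GIFS with diagonal linear parts\<close>

text \<open>The vertex set and the edge set are the finite types \<open>'v\<close> and \<open>'e\<close>; loops and multiple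
  edges are allowed.\<close>

record ('v, 'e) gifs =
  ini :: "'e \<Rightarrow> 'v"
  ter :: "'e \<Rightarrow> 'v"
  linpart :: "'e \<Rightarrow> real^2^2"
  transl :: "'e \<Rightarrow> real^2"

definition acoef :: "('v, 'e) gifs \<Rightarrow> 'e \<Rightarrow> real" where
  "acoef G e = \<bar>linpart G e $ 1 $ 1\<bar>"

definition bcoef :: "('v, 'e) gifs \<Rightarrow> 'e \<Rightarrow> real" where
  "bcoef G e = \<bar>linpart G e $ 2 $ 2\<bar>"

definition psi :: "('v, 'e) gifs \<Rightarrow> 'e \<Rightarrow> real^2 \<Rightarrow> real^2" where
  "psi G e \<xi> = linpart G e *v \<xi> + transl G e"

definition diagonal_box_like_gifs :: "('v::finite, 'e::finite) gifs \<Rightarrow> bool" where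
  "diagonal_box_like_gifs G \<longleftrightarrow>
     (\<forall>v. \<exists>e. ini G e = v) \<and>
     (\<forall>e. linpart G e $ 1 $ 2 = 0 \<and> linpart G e $ 2 $ 1 = 0 \<and>
          0 < acoef G e \<and> acoef G e < 1 \<and> 0 < bcoef G e \<and> bcoef G e < 1)"

definition words :: "('v, 'e) gifs \<Rightarrow> nat \<Rightarrow> 'e list set" where
  "words G k = {w. length w = k \<and> successively (\<lambda>e e'. ter G e = ini G e') w}"

definition joins :: "('v, 'e) gifs \<Rightarrow> 'v \<Rightarrow> 'e list \<Rightarrow> 'v \<Rightarrow> bool" where
  "joins G v w v' \<longleftrightarrow> ini G (hd w) = v \<and> ter G (last w) = v'"

definition strongly_connected :: "('v, 'e) gifs \<Rightarrow> bool" where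
  "strongly_connected G \<longleftrightarrow> (\<forall>v v'. \<exists>k\<ge>1. \<exists>w\<in>words G k. joins G v w v')"

definition ROSC :: "('v, 'e) gifs \<Rightarrow> bool" where
  "ROSC G \<longleftrightarrow> (\<forall>v. (\<forall>e. ini G e = v \<longrightarrow> psi G e ` box 0 One \<subseteq> box 0 One) \<and>
     disjoint_family_on (\<lambda>e. psi G e ` box 0 One) {e. ini G e = v})"

definition attractor_family :: "('v, 'e) gifs \<Rightarrow> ('v \<Rightarrow> (real^2) set) \<Rightarrow> bool" where
  "attractor_family G X \<longleftrightarrow>
     (\<forall>v. X v \<noteq> {} \<and> compact (X v) \<and> X v = (\<Union>e\<in>{e. ini G e = v}. psi G e ` X (ter G e)))"

definition associated_positive_vector :: "('v, 'e) gifs \<Rightarrow> ('e \<Rightarrow> real) \<Rightarrow> bool" where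
  "associated_positive_vector G p \<longleftrightarrow>
     (\<forall>e. p e > 0) \<and> (\<forall>v. (\<Sum>e\<in>{e. ini G e = v}. p e) = 1)"

definition associated_measure_family ::
  "('v, 'e) gifs \<Rightarrow> ('e \<Rightarrow> real) \<Rightarrow> ('v \<Rightarrow> (real^2) set) \<Rightarrow> ('v \<Rightarrow> (real^2) measure) \<Rightarrow> bool" where
  "associated_measure_family G p X \<mu> \<longleftrightarrow>
     (\<forall>v. prob_space (\<mu> v) \<and> sets (\<mu> v) = sets borel \<and> emeasure (\<mu> v) (- X v) = 0 \<and>
       (\<forall>B\<in>sets borel. measure (\<mu> v) B =
          (\<Sum>e\<in>{e. ini G e = v}. p e * measure (\<mu> (ter G e)) (psi G e -` B))))"

text \<open>The \<open>L\<^sup>q\<close>-spectra of the projections are known to exist and to be independent of the vertex.\<close>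

definition tauA :: "('v \<Rightarrow> (real^2) measure) \<Rightarrow> real \<Rightarrow> real" where
  "tauA \<mu> q = (THE \<tau>. \<forall>v. has_Lq_spectrum (distr (\<mu> v) borel (\<lambda>\<xi>. \<xi> $ 1)) q \<tau>)"

definition tauB :: "('v \<Rightarrow> (real^2) measure) \<Rightarrow> real \<Rightarrow> real" where
  "tauB \<mu> q = (THE \<tau>. \<forall>v. has_Lq_spectrum (distr (\<mu> v) borel (\<lambda>\<xi>. \<xi> $ 2)) q \<tau>)"

section \<open>The pressure function\<close>

definition word_prod :: "('e \<Rightarrow> real) \<Rightarrow> 'e list \<Rightarrow> real" where
  "word_prod c w = prod_list (map c w)"

definition alpha1 :: "('v, 'e) gifs \<Rightarrow> 'e list \<Rightarrow> real" where
  "alpha1 G w = max (word_prod (acoef G) w) (word_prod (bcoef G) w)"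

definition alpha2 :: "('v, 'e) gifs \<Rightarrow> 'e list \<Rightarrow> real" where
  "alpha2 G w = min (word_prod (acoef G) w) (word_prod (bcoef G) w)"

definition tau_word :: "('v, 'e) gifs \<Rightarrow> ('v \<Rightarrow> (real^2) measure) \<Rightarrow> 'e list \<Rightarrow> real \<Rightarrow> real" where
  "tau_word G \<mu> w q =
     (if word_prod (acoef G) w \<ge> word_prod (bcoef G) w then tauA \<mu> q else tauB \<mu> q)"

definition phi :: "('v, 'e) gifs \<Rightarrow> ('e \<Rightarrow> real) \<Rightarrow> ('v \<Rightarrow> (real^2) measure) \<Rightarrow>
    real \<Rightarrow> real \<Rightarrow> 'e list \<Rightarrow> real" where
  "phi G p \<mu> s q w = word_prod p w powr q * alpha1 G w powr tau_word G \<mu> w q *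
     alpha2 G w powr (s - tau_word G \<mu> w q)"

definition pressure_matrix :: "('v::finite, 'e::finite) gifs \<Rightarrow> ('e \<Rightarrow> real) \<Rightarrow>
    ('v \<Rightarrow> (real^2) measure) \<Rightarrow> real \<Rightarrow> real \<Rightarrow> nat \<Rightarrow> real^'v^'v" where
  "pressure_matrix G p \<mu> s q k =
     (\<chi> v v'. \<Sum>w\<in>{w\<in>words G k. joins G v w v'}. phi G p \<mu> s q w)"

definition pressure :: "('v::finite, 'e::finite) gifs \<Rightarrow> ('e \<Rightarrow> real) \<Rightarrow>
    ('v \<Rightarrow> (real^2) measure) \<Rightarrow> real \<Rightarrow> real \<Rightarrow> real" where
  "pressure G p \<mu> s q =
     lim (\<lambda>k. root k (\<Sum>v\<in>UNIV. \<Sum>v'\<in>UNIV. \<bar>pressure_matrix G p \<mu> s q k $ v $ v'\<bar>))"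

definition gamma :: "('v::finite, 'e::finite) gifs \<Rightarrow> ('e \<Rightarrow> real) \<Rightarrow>
    ('v \<Rightarrow> (real^2) measure) \<Rightarrow> real \<Rightarrow> real" where
  "gamma G p \<mu> q = (THE s. pressure G p \<mu> s q = 1)"

section \<open>The edge-indexed matrices\<close>

definition Fmat :: "('v, 'e::finite) gifs \<Rightarrow> ('e \<Rightarrow> real) \<Rightarrow> real \<Rightarrow> real \<Rightarrow> real \<Rightarrow> real^'e^'e" where
  "Fmat G p q x y = (\<chi> e e'. if ter G e = ini G e'
     then p e' powr q * acoef G e' powr x * bcoef G e' powr y else 0)"

definition gammaA :: "('v, 'e::finite) gifs \<Rightarrow> ('e \<Rightarrow> real) \<Rightarrow>
    ('v \<Rightarrow> (real^2) measure) \<Rightarrow> real \<Rightarrow> real" where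
  "gammaA G p \<mu> q = (THE g. spectral_radius (Fmat G p q (tauA \<mu> q) (g - tauA \<mu> q)) = 1)"

definition gammaB :: "('v, 'e::finite) gifs \<Rightarrow> ('e \<Rightarrow> real) \<Rightarrow>
    ('v \<Rightarrow> (real^2) measure) \<Rightarrow> real \<Rightarrow> real" where
  "gammaB G p \<mu> q = (THE g. spectral_radius (Fmat G p q (g - tauB \<mu> q) (tauB \<mu> q)) = 1)"

definition y_of :: "('v, 'e::finite) gifs \<Rightarrow> ('e \<Rightarrow> real) \<Rightarrow> real \<Rightarrow> real \<Rightarrow> real" where
  "y_of G p q x = (THE y. spectral_radius (Fmat G p q x y) = 1)"

definition f_weight :: "('v, 'e::finite) gifs \<Rightarrow> ('e \<Rightarrow> real) \<Rightarrow> real \<Rightarrow> 'e \<Rightarrow> real \<Rightarrow> real" where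
  "f_weight G p q e x = left_perron_vector (Fmat G p q x (y_of G p q x)) $ e *
     right_perron_vector (Fmat G p q x (y_of G p q x)) $ e"

end

theory Submission
  imports Defs
begin

text \<open>The function \<open>\<gamma>\<close> is compared with the level curve \<open>\<rho> (F x y) = 1\<close>. Put \<open>h x y = ln (\<rho> (F x y))\<close>. For
  irreducible \<open>F\<close>, Perron-Frobenius theory (\<open>perron_vectors\<close>) and a Jensen inequality
  (\<open>ln_spectral_radius_support\<close>) provide supporting planes of \<open>h\<close> whose slopes are averages of
  \<open>ln a\<^sub>e\<close> and \<open>ln b\<^sub>e\<close> with respect to the Perron weights, which are the
  \<open>f\<^sub>e\<close> where \<open>h\<close> vanishes. So \<open>h\<close> is convex and strictly decreasing in
  both variables, and \<open>ln_spectral_radius_scale_exp_derivative\<close> shows that the slope along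
  \<open>x + y = s\<close> is a true derivative; on the curve it is the sum \<open>\<Sum> f\<^sub>e ln (a\<^sub>e / b\<^sub>e)\<close>.

  For a fixed \<open>s\<close>, the function \<open>\<phi>\<close> is made from the two multiplicative weights
  \<open>p\<^sub>w\<^sup>q a\<^sub>w\<^sup>x b\<^sub>w\<^sup>y\<close> on the line \<open>x + y = s\<close> at \<open>x = \<tau>\<^sub>A\<close> and at \<open>y = \<tau>\<^sub>B\<close>: it is their maximum for
  \<open>s \<le> t\<close> and their minimum for \<open>s \<ge> t\<close>. The sum of a multiplicative weight over words of length \<open>k\<close>
  grows like \<open>\<rho>\<^sup>k\<close> (\<open>word_sum_growth\<close>). Hence for \<open>s \<le> t\<close> the pressure is the larger of the two
  Perron roots (\<open>pressure_below\<close>). For \<open>s \<ge> t\<close> it is the minimum of \<open>\<rho>\<close> over the segment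
  between the two points (\<open>pressure_above\<close>). The upper bound there is immediate. The lower bound is a
  large deviation argument: at the minimizer \<open>h\<close> has derivative zero along the segment, or the
  minimizer is an end at which \<open>h\<close> does not decrease into the segment, so that almost all of the weight sits on words for which \<open>ln (a\<^sub>w / b\<^sub>w)\<close>, as far as it
  matters, is \<open>o(k)\<close> (\<open>tilted_tail\<close>), and on those words the minimum loses only a subexponential
  factor.

  The rest is plane geometry of the convex decreasing curve \<open>h = 0\<close>. It meets the vertical line
  \<open>x = \<tau>\<^sub>A\<close> at coordinate sum \<open>\<gamma>\<^sub>A\<close> and the horizontal line \<open>y = \<tau>\<^sub>B\<close> at coordinate sum \<open>\<gamma>\<^sub>B\<close>, and the sign
  of \<open>h\<close> at the corner \<open>(\<tau>\<^sub>A, \<tau>\<^sub>B)\<close> decides between the two alternatives. If it is nonpositive, the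
  maximum of \<open>x + y\<close> on the arc is attained at an end, by convexity. If it is nonnegative, \<open>\<gamma>\<close> is the
  minimum of \<open>x + y\<close> on the arc, and the sign of the slope \<open>\<Sum> f\<^sub>e ln (a\<^sub>e / b\<^sub>e)\<close> at the two ends tells
  whether the minimum is at an end or at an interior critical point.\<close>

section \<open>Perron-Frobenius theory for irreducible nonnegative matrices\<close>

text \<open>Irreducibility is expressed through the directed graph of the positive entries: every index
  reaches every index, itself included, by a nonempty path. For the edge-indexed matrices of a
  directed graph this is strong connectedness of the graph.\<close>

definition irreducible_nonneg :: "real^'n^'n \<Rightarrow> bool" where
  "irreducible_nonneg M \<longleftrightarrow>
     (\<forall>i j. 0 \<le> M $ i $ j) \<and> (\<forall>i j. (i, j) \<in> {(i, j). 0 < M $ i $ j}\<^sup>+)"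

lemma irreducible_nonneg_transpose:
  assumes "irreducible_nonneg M"
  shows "irreducible_nonneg (transpose M)"
proof -
  have "{(i, j). 0 < transpose M $ i $ j} = {(i, j). 0 < M $ i $ j}\<inverse>"
    by (auto simp: transpose_def)
  then show ?thesis
    using assms by (simp add: irreducible_nonneg_def trancl_converse) (simp add: transpose_def)
qed

lemma matrix_vector_component: "(M *v x) $ i = (\<Sum>j\<in>UNIV. M $ i $ j * x $ j)"
  by (simp add: matrix_vector_mult_def)

text \<open>Positivity of one coordinate of a nonnegative eigenvector propagates backwards along every
  positive entry of the matrix, hence to all coordinates.\<close>

lemma irreducible_nonneg_eigenvector_pos:
  fixes M :: "real^'n^'n"
  assumes M: "irreducible_nonneg M" and eig: "M *v x = r *\<^sub>R x"
    and nonneg: "\<And>i. 0 \<le> x $ i" and nz: "x \<noteq> 0"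
  shows "0 < x $ i" and "0 < r"
proof -
  have one_step: "0 < r * x $ i" if "0 < M $ i $ j" "0 < x $ j" for i j
  proof -
    have "0 < M $ i $ j * x $ j" using that by simp
    also have "\<dots> \<le> (\<Sum>k\<in>UNIV. M $ i $ k * x $ k)"
      using M nonneg by (intro member_le_sum) (auto simp: irreducible_nonneg_def)
    also have "\<dots> = r * x $ i"
      using arg_cong[OF eig, of "\<lambda>y. y $ i"] by (simp add: matrix_vector_component)
    finally show ?thesis .
  qed
  obtain j where j: "0 < x $ j"
    using nz nonneg by (auto simp: vec_eq_iff less_eq_real_def)
  have pos: "0 < x $ i" for i
  proof -
    have "(i, j) \<in> {(i, j). 0 < M $ i $ j}\<^sup>+"
      using M by (simp add: irreducible_nonneg_def)
    then show ?thesis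
    proof (induction rule: converse_trancl_induct)
      case (base y)
      then show ?case using one_step[of y j] j nonneg[of y] by (auto simp: zero_less_mult_iff)
    next
      case (step y z)
      then show ?case using one_step[of y z] nonneg[of y]
        by (auto simp: zero_less_mult_iff)
    qed
  qed
  show "0 < x $ i" by (rule pos)
  obtain k where "0 < M $ i $ k"
    using M tranclD[of i i "{(i, j). 0 < M $ i $ j}"] by (auto simp: irreducible_nonneg_def)
  from one_step[OF this pos] pos[of i] show "0 < r" by (simp add: zero_less_mult_iff)
qed

text \<open>The map \<open>x \<mapsto> M x\<close>, rescaled to coordinate sum one, is a continuous self-map of the standard
  simplex, and a fixed point supplied by Brouwer's theorem is an eigenvector.\<close>

lemma ex_perron_eigenvector:
  fixes M :: "real^'n^'n"
  assumes M: "irreducible_nonneg M"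
  shows "\<exists>r u. 0 < r \<and> (\<forall>i. 0 < u $ i) \<and> M *v u = r *\<^sub>R u"
proof -
  define S :: "(real^'n) set" where "S = {x. (\<forall>i. 0 \<le> x $ i) \<and> (\<Sum>i\<in>UNIV. x $ i) = 1}"
  define N where "N x = (\<Sum>i\<in>UNIV. (M *v x) $ i)" for x
  define f where "f x = (1 / N x) *\<^sub>R (M *v x)" for x
  have "closed S"
  proof -
    have "S = (\<Inter>i. {x. 0 \<le> x $ i}) \<inter> {x. (\<Sum>i\<in>UNIV. x $ i) = 1}" by (auto simp: S_def)
    then show ?thesis
      by (auto intro!: closed_INT closed_Int closed_Collect_le closed_Collect_eq continuous_intros)
  qed
  moreover have "bounded S"
  proof -
    have "norm x \<le> 1" if "x \<in> S" for x
      using norm_le_l1_cart[of x] that by (simp add: S_def)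
    then show ?thesis by (auto simp: bounded_iff)
  qed
  ultimately have comp: "compact S" by (simp add: compact_eq_bounded_closed)
  have conv: "convex S"
    unfolding convex_def S_def
    by (auto simp: sum.distrib sum_distrib_left[symmetric])
  have "axis undefined 1 \<in> S"
    by (auto simp: S_def axis_def if_distrib cong: if_cong)
  then have ne: "S \<noteq> {}" by blast
  have Mnn: "0 \<le> (M *v x) $ i" if "x \<in> S" for x i
    using M that by (auto simp: matrix_vector_component S_def irreducible_nonneg_def intro!: sum_nonneg)
  have Npos: "0 < N x" if "x \<in> S" for x
  proof -
    have "\<exists>j. x $ j \<noteq> 0"
    proof (rule ccontr)
      assume "\<not> (\<exists>j. x $ j \<noteq> 0)"
      then show False using that by (simp add: S_def)
    qed
    then obtain j where "x $ j \<noteq> 0" by blast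
    moreover have "0 \<le> x $ j" using that by (simp add: S_def)
    ultimately have j: "0 < x $ j" by simp
    have "(j, j) \<in> {(i, j). 0 < M $ i $ j}\<^sup>+" using M by (simp add: irreducible_nonneg_def)
    then obtain i where "0 < M $ i $ j" by (blast dest: tranclD2)
    then have "0 < M $ i $ j * x $ j" using j by simp
    also have "\<dots> \<le> (M *v x) $ i"
      unfolding matrix_vector_component using M that
      by (intro member_le_sum) (auto simp: irreducible_nonneg_def S_def)
    also have "\<dots> \<le> N x"
      unfolding N_def using Mnn[OF that] by (intro member_le_sum) auto
    finally show ?thesis .
  qed
  have contM: "continuous_on S (\<lambda>x. M *v x)"
    by (intro linear_continuous_on matrix_vector_mul_bounded_linear)
  have contN: "continuous_on S N"
    unfolding N_def by (intro continuous_intros contM)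
  have "continuous_on S f"
    unfolding f_def using Npos by (intro continuous_intros contM contN) fastforce
  moreover have "f \<in> S \<rightarrow> S"
  proof
    fix x assume x: "x \<in> S"
    have "(\<Sum>i\<in>UNIV. f x $ i) = 1"
      using Npos[OF x] by (simp add: f_def sum_divide_distrib[symmetric] N_def)
    then show "f x \<in> S"
      using Npos[OF x] Mnn[OF x] by (simp add: S_def f_def)
  qed
  ultimately obtain x where x: "x \<in> S" "f x = x"
    using brouwer[OF comp conv ne] by blast
  have "M *v x = N x *\<^sub>R f x"
    using Npos[OF x(1)] by (simp add: f_def)
  then have eig: "M *v x = N x *\<^sub>R x" using x by simp
  have "x \<noteq> 0" using x(1) by (auto simp: S_def)
  with irreducible_nonneg_eigenvector_pos(1)[OF M eig] x(1) Npos[OF x(1)] eig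
  show ?thesis unfolding S_def by blast
qed

text \<open>The spectral radius, a maximum over the set of eigenvalues, is meaningful only if this set is
  finite. Eigenvalues are the roots of \<open>det (M - z)\<close>, which is written out as a polynomial in \<open>z\<close>
  by the Leibniz formula; it is not the zero polynomial because eigenvalues are bounded by the sum of the moduli of the
  entries.\<close>

lemma finite_eigenvalues: "finite (eigenvalues (M :: real^'n^'n))"
proof -
  define C where "C = (\<chi> i j. complex_of_real (M $ i $ j))"
  define P where "P = (\<Sum>\<sigma> | \<sigma> permutes UNIV. smult (of_int (sign \<sigma>))
     (\<Prod>i\<in>UNIV. if \<sigma> i = i then [: C $ i $ i, - 1 :] else [: C $ i $ \<sigma> i :]))"
  have P: "poly P z = det (C - mat z)" for z
    unfolding P_def det_def
    by (auto simp: poly_sum poly_prod mat_def if_distrib intro!: sum.cong prod.cong)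
  have scal: "mat z *v v = z *s v" for v :: "complex^'n" and z
    by (simp add: vec_eq_iff matrix_vector_mult_def mat_def if_distrib[of "\<lambda>c. c * _"]
        cong: if_cong)
  have "C *v v = z *s v \<longleftrightarrow> (C - mat z) *v v = 0" for v z
    by (simp add: matrix_vector_mult_diff_rdistrib scal)
  then have ev: "z \<in> eigenvalues M \<longleftrightarrow> poly P z = 0" for z
    unfolding P using matrix_left_invertible_ker[of "C - mat z"]
      invertible_det_nz[of "C - mat z"]
    unfolding eigenvalues_def C_def[symmetric] invertible_left_inverse by auto
  have "P \<noteq> 0"
  proof
    assume "P = 0"
    then have all: "z \<in> eigenvalues M" for z using ev by simp
    define K where "K = (\<Sum>i\<in>UNIV. \<Sum>j\<in>UNIV. \<bar>M $ i $ j\<bar>)"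
    have "complex_of_real (K + 1) \<in> eigenvalues M" by (rule all)
    then obtain v where v: "v \<noteq> 0" "C *v v = complex_of_real (K + 1) *s v"
      unfolding eigenvalues_def C_def by blast
    define m where "m = Max (range (\<lambda>i. cmod (v $ i)))"
    have m: "cmod (v $ i) \<le> m" for i unfolding m_def by simp
    obtain i where i: "cmod (v $ i) = m"
      unfolding m_def using Max_in[of "range (\<lambda>i. cmod (v $ i))"] by fastforce
    obtain k where "v $ k \<noteq> 0" using v(1) by (auto simp: vec_eq_iff)
    then have "0 < m" using m[of k] zero_less_norm_iff[of "v $ k"] by linarith
    have K0: "0 \<le> K" unfolding K_def by (intro sum_nonneg) auto
    (* At a coordinate i of maximal modulus m, the eigenvalue K + 1 would give (K + 1) m \<le> K m. *)
    have "(K + 1) * m = cmod ((C *v v) $ i)"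
      using v(2) i K0 by (simp add: norm_mult del: of_real_add)
    also have "\<dots> \<le> (\<Sum>j\<in>UNIV. \<bar>M $ i $ j\<bar> * m)"
      unfolding matrix_vector_mult_def C_def
      by (auto simp: norm_mult intro!: sum_norm_le mult_left_mono m)
    also have "\<dots> = (\<Sum>j\<in>UNIV. \<bar>M $ i $ j\<bar>) * m" by (simp add: sum_distrib_right)
    also have "\<dots> \<le> K * m"
      unfolding K_def using \<open>0 < m\<close>
      by (intro mult_right_mono member_le_sum) (auto intro: sum_nonneg)
    finally show False using \<open>0 < m\<close> by (simp add: distrib_right)
  qed
  then show ?thesis using poly_roots_finite[of P] ev by (metis (mono_tags, lifting) Collect_cong Collect_mem_eq)
qed

text \<open>Pairing a left Perron vector with a right one shows that both have the same eigenvalue.\<close>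

lemma left_perron_value:
  fixes M :: "real^'n^'n"
  assumes M: "irreducible_nonneg M" and u: "\<And>i. 0 < u $ i" "M *v u = r *\<^sub>R u"
  shows "\<exists>v. (\<forall>i. 0 < v $ i) \<and> v v* M = r *\<^sub>R v"
proof -
  obtain r' v where v: "\<And>i. 0 < v $ i" "transpose M *v v = r' *\<^sub>R v"
    using ex_perron_eigenvector[OF irreducible_nonneg_transpose[OF M]] by blast
  have vM: "v v* M = r' *\<^sub>R v" using v(2) by simp
  have "r' * (v \<bullet> u) = (v v* M) \<bullet> u" by (simp add: vM)
  also have "\<dots> = v \<bullet> (M *v u)" using dot_lmul_matrix[of v M u] by simp
  also have "\<dots> = r * (v \<bullet> u)" by (simp add: u)
  finally have "(r' - r) * (v \<bullet> u) = 0" by (simp add: algebra_simps)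
  moreover have "0 < v \<bullet> u"
    unfolding inner_vec_def using u v by (auto intro!: sum_pos)
  ultimately have "r' = r" by simp
  then show ?thesis using v(1) vM by blast
qed

text \<open>If \<open>M v = z v\<close>, then \<open>\<bar>z\<bar> \<bar>v\<bar> \<le> M \<bar>v\<bar>\<close> coordinatewise; pairing with a positive left eigenvector
  turns this into \<open>\<bar>z\<bar> \<le> r\<close>.\<close>

lemma spectral_radius_eq_perron_value:
  fixes M :: "real^'n^'n"
  assumes M: "irreducible_nonneg M" and u: "\<And>i. 0 < u $ i" "M *v u = r *\<^sub>R u"
  shows "spectral_radius M = r"
proof -
  have "u \<noteq> 0" using u(1) by (metis less_irrefl zero_index)
  have r: "0 < r" using irreducible_nonneg_eigenvector_pos(2)[OF M u(2)] u(1) \<open>u \<noteq> 0\<close> by (meson less_imp_le)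
  obtain l where l: "\<And>i. 0 < l $ i" "l v* M = r *\<^sub>R l"
    using left_perron_value[OF M u] by blast
  have le: "cmod z \<le> r" if z: "z \<in> eigenvalues M" for z
  proof -
    obtain v where v: "v \<noteq> 0" "(\<chi> i j. complex_of_real (M $ i $ j)) *v v = z *s v"
      using z unfolding eigenvalues_def by blast
    define w :: "real^'n" where "w = (\<chi> i. cmod (v $ i))"
    have ineq: "cmod z * w $ i \<le> (M *v w) $ i" for i
    proof -
      have "cmod z * w $ i = cmod (\<Sum>j\<in>UNIV. complex_of_real (M $ i $ j) * v $ j)"
        using arg_cong[OF v(2), of "\<lambda>x. cmod (x $ i)"] 
        by (simp add: matrix_vector_mult_def w_def norm_mult)
      also have "\<dots> \<le> (\<Sum>j\<in>UNIV. M $ i $ j * cmod (v $ j))"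
        using M by (intro sum_norm_le) (simp add: norm_mult irreducible_nonneg_def)
      finally show ?thesis by (simp add: matrix_vector_component w_def)
    qed
    have "cmod z * (l \<bullet> w) \<le> l \<bullet> (M *v w)"
      unfolding inner_vec_def sum_distrib_left
      using mult_left_mono[OF ineq less_imp_le[OF l(1)]] by (auto intro!: sum_mono simp: mult_ac)
    also have "\<dots> = r * (l \<bullet> w)" using l(2) dot_lmul_matrix[of l M w] by simp
    finally have "cmod z * (l \<bullet> w) \<le> r * (l \<bullet> w)" .
    moreover have "0 < l \<bullet> w"
    proof -
      obtain i where "v $ i \<noteq> 0" using v(1) by (metis vec_eq_iff zero_index)
      then show ?thesis
        unfolding inner_vec_def using l(1)
        by (intro sum_pos2[of _ i]) (auto simp: w_def less_imp_le)
    qed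
    ultimately show ?thesis by simp
  qed
  have mem: "complex_of_real r \<in> eigenvalues M"
    unfolding eigenvalues_def
  proof (intro CollectI exI conjI)
    show "(\<chi> i. complex_of_real (u $ i)) \<noteq> 0" using \<open>u \<noteq> 0\<close> by (auto simp: vec_eq_iff)
    have "(\<Sum>j\<in>UNIV. M $ i $ j * u $ j) = r * u $ i" for i
      using arg_cong[OF u(2), of "\<lambda>y. y $ i"] by (simp add: matrix_vector_component)
    then show "(\<chi> i j. complex_of_real (M $ i $ j)) *v (\<chi> i. complex_of_real (u $ i)) =
        complex_of_real r *s (\<chi> i. complex_of_real (u $ i))"
      by (simp add: vec_eq_iff matrix_vector_mult_def flip: of_real_mult of_real_sum)
  qed
  show ?thesis
    unfolding spectral_radius_def
  proof (rule Max_eqI)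
    show "finite (cmod ` eigenvalues M)" using finite_eigenvalues by blast
    show "y \<le> r" if "y \<in> cmod ` eigenvalues M" for y using that le by blast
    show "r \<in> cmod ` eigenvalues M" using mem r by (metis abs_of_pos image_eqI norm_of_real)
  qed
qed

text \<open>Subtracting the largest multiple of \<open>u\<close> that keeps \<open>x\<close> nonnegative leaves a nonnegative
  eigenvector with a vanishing coordinate, which must be zero.\<close>

lemma perron_eigenvector_unique:
  fixes M :: "real^'n^'n"
  assumes M: "irreducible_nonneg M"
    and x: "\<And>i. 0 < x $ i" "M *v x = r *\<^sub>R x" and u: "\<And>i. 0 < u $ i" "M *v u = r *\<^sub>R u"
  shows "\<exists>c>0. x = c *\<^sub>R u"
proof -
  define c where "c = Min (range (\<lambda>i. x $ i / u $ i))"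
  have c: "c \<le> x $ i / u $ i" for i unfolding c_def by simp
  obtain i where i: "c = x $ i / u $ i"
    unfolding c_def using Min_in[of "range (\<lambda>i. x $ i / u $ i)"] by fastforce
  define y where "y = x - c *\<^sub>R u"
  have ynn: "0 \<le> y $ j" for j using c[of j] u(1)[of j] by (simp add: y_def field_simps)
  have yi: "y $ i = 0" using u(1)[of i] by (simp add: y_def i)
  have "M *v y = r *\<^sub>R y"
    by (simp add: y_def matrix_vector_mult_diff_distrib x u vec.scale matrix_vector_mult_scaleR
        scaleR_diff_right scaleR_left_commute)
  then have "y = 0"
    using irreducible_nonneg_eigenvector_pos(1)[OF M _ ynn, of r i] yi by force
  moreover have "0 < c" using x(1)[of i] u(1)[of i] by (simp add: i)
  ultimately show ?thesis by (auto simp: y_def)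
qed

section \<open>Dependence of the Perron root on column weights\<close>

text \<open>The entrywise product of the left and right Perron vectors is a probability vector: the
  stationary distribution of the Markov chain \<open>M\<^sub>i\<^sub>j u\<^sub>j / (r u\<^sub>i)\<close>. Dividing the matrix by its spectral
  radius turns eigenvectors into fixed vectors, which is what \<open>right_perron_vector\<close> and
  \<open>left_perron_vector\<close> ask for.\<close>

definition perron_weight :: "real^'n^'n \<Rightarrow> 'n \<Rightarrow> real" where
  "perron_weight M j =
     left_perron_vector ((1 / spectral_radius M) *\<^sub>R M) $ j *
     right_perron_vector ((1 / spectral_radius M) *\<^sub>R M) $ j"

lemma perron_vectors:
  fixes M :: "real^'n^'n"
  assumes M: "irreducible_nonneg M"
  obtains u v where "0 < spectral_radius M" "\<And>i. 0 < u $ i" "\<And>i. 0 < v $ i"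
    "M *v u = spectral_radius M *\<^sub>R u" "v v* M = spectral_radius M *\<^sub>R v"
    "norm u = 1" "v \<bullet> u = 1" "\<And>j. perron_weight M j = v $ j * u $ j"
proof -
  define r where "r = spectral_radius M"
  define N where "N = (1 / r) *\<^sub>R M"
  obtain r' u0 where u0: "0 < r'" "\<And>i. 0 < u0 $ i" "M *v u0 = r' *\<^sub>R u0"
    using ex_perron_eigenvector[OF M] by blast
  have r': "r' = r" using spectral_radius_eq_perron_value[OF M u0(2,3)] by (simp add: r_def)
  have r: "0 < r" using u0(1) r' by simp
  have "u0 \<noteq> 0" using u0(2) by (metis less_irrefl zero_index)
  define u where "u = (1 / norm u0) *\<^sub>R u0"
  have u: "\<And>i. 0 < u $ i" "M *v u = r *\<^sub>R u" "norm u = 1"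
    using u0 \<open>u0 \<noteq> 0\<close> r' by (auto simp: u_def matrix_vector_mult_scaleR)
  obtain v0 where v0: "\<And>i. 0 < v0 $ i" "v0 v* M = r *\<^sub>R v0"
    using left_perron_value[OF M u(1,2)] by blast
  have v0u: "0 < v0 \<bullet> u"
    unfolding inner_vec_def using u(1) v0(1) by (auto intro!: sum_pos)
  define v where "v = (1 / (v0 \<bullet> u)) *\<^sub>R v0"
  have v: "\<And>i. 0 < v $ i" "v v* M = r *\<^sub>R v" "v \<bullet> u = 1"
    using v0 v0u by (auto simp: v_def matrix_vector_mult_scaleR simp flip: transpose_matrix_vector)
  have N: "N *v x = x \<longleftrightarrow> M *v x = r *\<^sub>R x" "x v* N = x \<longleftrightarrow> x v* M = r *\<^sub>R x" for x
  proof -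
    have 1: "N *v x = (1 / r) *\<^sub>R (M *v x)" "x v* N = (1 / r) *\<^sub>R (x v* M)"
      by (simp_all add: N_def vec_eq_iff matrix_vector_mult_def vector_matrix_mult_def sum_distrib_left mult_ac)
    have 2: "(1 / r) *\<^sub>R y = x \<longleftrightarrow> y = r *\<^sub>R x" for y
      using r by (auto simp: vec_eq_iff field_simps)
    show "N *v x = x \<longleftrightarrow> M *v x = r *\<^sub>R x" "x v* N = x \<longleftrightarrow> x v* M = r *\<^sub>R x"
      unfolding 1 2 by auto
  qed
  have right: "right_perron_vector N = u"
    unfolding right_perron_vector_def N
  proof (rule the_equality)
    fix x assume x: "(\<forall>i. 0 < x $ i) \<and> norm x = 1 \<and> M *v x = r *\<^sub>R x"
    then obtain c where "c > 0" "x = c *\<^sub>R u"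
      using perron_eigenvector_unique[OF M _ _ u(1,2), of x] by blast
    then show "x = u" using x u(3) by auto
  qed (use u in auto)
  have left: "left_perron_vector N = v"
    unfolding left_perron_vector_def right N
  proof (rule the_equality)
    fix x assume x: "(\<forall>i. 0 < x $ i) \<and> x v* M = r *\<^sub>R x \<and> (\<Sum>i\<in>UNIV. x $ i * u $ i) = 1"
    then obtain c where "c > 0" "x = c *\<^sub>R v"
      using perron_eigenvector_unique[OF irreducible_nonneg_transpose[OF M], of x r v] v
      by auto
    moreover have "x \<bullet> u = 1" using x by (simp add: inner_vec_def)
    ultimately show "x = v" using v(3) by auto
  qed (use v in \<open>auto simp: inner_vec_def\<close>)
  show ?thesis
    using that[of u v] u v r left right by (simp add: perron_weight_def N_def r_def)
qed

lemma spectral_radius_pos: "irreducible_nonneg M \<Longrightarrow> 0 < spectral_radius M"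
  by (rule perron_vectors)

lemma perron_weight_pos: "irreducible_nonneg M \<Longrightarrow> 0 < perron_weight M j"
  by (rule perron_vectors) auto

lemma sum_perron_weight: "irreducible_nonneg M \<Longrightarrow> (\<Sum>j\<in>UNIV. perron_weight M j) = 1"
  by (rule perron_vectors) (auto simp: inner_vec_def)

definition scale_columns :: "real^'n^'n \<Rightarrow> ('n \<Rightarrow> real) \<Rightarrow> real^'n^'n" where
  "scale_columns M d = (\<chi> i j. M $ i $ j * d j)"

lemma scale_columns_one: "scale_columns M (\<lambda>j. 1) = M"
  by (simp add: scale_columns_def vec_eq_iff)

lemma scale_columns_twice: "scale_columns (scale_columns M d) d' = scale_columns M (\<lambda>j. d j * d' j)"
  by (simp add: scale_columns_def vec_eq_iff mult.assoc)

lemma irreducible_nonneg_scale_columns: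
  assumes "irreducible_nonneg M" and d: "\<And>j. 0 < d j"
  shows "irreducible_nonneg (scale_columns M d)"
proof -
  have "{(i, j). 0 < scale_columns M d $ i $ j} = {(i, j). 0 < M $ i $ j}"
    using d by (auto simp: scale_columns_def zero_less_mult_iff less_imp_le dest: less_asym)
  then show ?thesis
    using assms(1) d by (simp add: irreducible_nonneg_def) (simp add: scale_columns_def less_imp_le)
qed

text \<open>This is Jensen's inequality for the stationary Markov chain of \<open>M\<close>, along which the logarithm of
  the scaling factor has the mean \<open>\<Sum> \<pi> ln d\<close> per step. Let \<open>w\<close> be the Perron vector of the scaled matrix,
  and let \<open>z\<^sub>i\<^sub>j = r u\<^sub>i d\<^sub>j w\<^sub>j / (u\<^sub>j s w\<^sub>i)\<close>; then \<open>ln z \<le> z - 1\<close> is averaged with the weights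
  \<open>v\<^sub>i M\<^sub>i\<^sub>j u\<^sub>j\<close>. The right-hand side averages to zero, and in the logarithm the terms
  \<open>ln (u\<^sub>i / w\<^sub>i) - ln (u\<^sub>j / w\<^sub>j)\<close> cancel because both marginals of these weights are \<open>r v\<^sub>i u\<^sub>i\<close>.

  Since the bound holds at every base point, it yields at once convexity, monotonicity and
  Lipschitz continuity of \<open>ln \<rho>\<close> in the logarithms of the column weights.\<close>

theorem ln_spectral_radius_support:
  fixes M :: "real^'n^'n"
  assumes M: "irreducible_nonneg M" and d: "\<And>j. 0 < d j"
  shows "ln (spectral_radius M) + (\<Sum>j\<in>UNIV. perron_weight M j * ln (d j))
    \<le> ln (spectral_radius (scale_columns M d))"
proof -
  define r s where "r = spectral_radius M" and "s = spectral_radius (scale_columns M d)"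
  obtain u v where u: "0 < r" "\<And>i. 0 < u $ i" "M *v u = r *\<^sub>R u"
    and v: "\<And>i. 0 < v $ i" "v v* M = r *\<^sub>R v" "v \<bullet> u = 1"
    and \<pi>: "\<And>j. perron_weight M j = v $ j * u $ j"
    unfolding r_def by (rule perron_vectors[OF M]) blast
  obtain w where w: "0 < s" "\<And>i. 0 < w $ i" "scale_columns M d *v w = s *\<^sub>R w"
    unfolding s_def by (rule perron_vectors[OF irreducible_nonneg_scale_columns[of M d, OF M d]]) blast
  have row: "(\<Sum>j\<in>UNIV. M $ i $ j * u $ j) = r * u $ i" for i
    using arg_cong[OF u(3), of "\<lambda>y. y $ i"] by (simp add: matrix_vector_component)
  have col: "(\<Sum>i\<in>UNIV. v $ i * M $ i $ j) = r * v $ j" for j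
    using arg_cong[OF v(2), of "\<lambda>y. y $ j"] by (simp add: vector_matrix_mult_def mult.commute)
  have row': "(\<Sum>j\<in>UNIV. M $ i $ j * d j * w $ j) = s * w $ i" for i
    using arg_cong[OF w(3), of "\<lambda>y. y $ i"] by (simp add: matrix_vector_component scale_columns_def)
  have vu: "(\<Sum>i\<in>UNIV. v $ i * u $ i) = 1" using v(3) by (simp add: inner_vec_def)
  define q where "q i j = v $ i * M $ i $ j * u $ j" for i j
  have qnn: "0 \<le> q i j" for i j
    using M u(2)[of j] v(1)[of i] by (simp add: q_def irreducible_nonneg_def)
  have qrow: "(\<Sum>j\<in>UNIV. q i j) = r * (v $ i * u $ i)" for i
    using row[of i] by (simp add: q_def mult.assoc flip: sum_distrib_left)
  have qcol: "(\<Sum>i\<in>UNIV. q i j) = r * (v $ j * u $ j)" for j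
    using col[of j] by (simp add: q_def flip: sum_distrib_right)
  define z where "z i j = r * u $ i * d j * w $ j / (u $ j * s * w $ i)" for i j
  define g where "g i = ln (u $ i) - ln (w $ i)" for i
  have lnz: "ln (z i j) = ln r - ln s + ln (d j) + (g i - g j)" for i j
    using u(1) u(2)[of i] u(2)[of j] w(1) w(2)[of i] w(2)[of j] d[of j]
    by (simp add: z_def g_def ln_mult ln_div)
  have z: "0 < z i j" for i j
    using u(1,2) w(1,2) d by (simp add: z_def)
  have "(\<Sum>i\<in>UNIV. \<Sum>j\<in>UNIV. q i j * ln (z i j)) \<le> (\<Sum>i\<in>UNIV. \<Sum>j\<in>UNIV. q i j * (z i j - 1))"
    by (intro sum_mono mult_left_mono ln_le_minus_one z qnn)
  also have "\<dots> = (\<Sum>i\<in>UNIV. \<Sum>j\<in>UNIV. q i j * z i j) - (\<Sum>i\<in>UNIV. \<Sum>j\<in>UNIV. q i j)"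
    by (simp add: right_diff_distrib sum_subtractf)
  also have "(\<Sum>i\<in>UNIV. \<Sum>j\<in>UNIV. q i j) = r"
    using vu by (simp add: qrow flip: sum_distrib_left)
  also have "(\<Sum>i\<in>UNIV. \<Sum>j\<in>UNIV. q i j * z i j) = (\<Sum>i\<in>UNIV. r * (v $ i * u $ i))"
  proof (rule sum.cong[OF refl])
    fix i
    have "q i j * z i j = r * v $ i * u $ i / (s * w $ i) * (M $ i $ j * d j * w $ j)" for j
      using u(2)[of j] by (simp add: q_def z_def)
    then have "(\<Sum>j\<in>UNIV. q i j * z i j) =
        r * v $ i * u $ i / (s * w $ i) * (\<Sum>j\<in>UNIV. M $ i $ j * d j * w $ j)"
      by (simp add: sum_distrib_left)
    then show "(\<Sum>j\<in>UNIV. q i j * z i j) = r * (v $ i * u $ i)"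
      using w(1) w(2)[of i] by (simp add: row')
  qed
  also have "\<dots> = r" using vu by (simp flip: sum_distrib_left)
  finally have le: "(\<Sum>i\<in>UNIV. \<Sum>j\<in>UNIV. q i j * ln (z i j)) \<le> 0" by simp
  have "(\<Sum>i\<in>UNIV. \<Sum>j\<in>UNIV. q i j * g j) = (\<Sum>j\<in>UNIV. r * (v $ j * u $ j) * g j)"
    by (subst sum.swap) (simp add: qcol flip: sum_distrib_right)
  moreover have "(\<Sum>i\<in>UNIV. \<Sum>j\<in>UNIV. q i j * g i) = (\<Sum>j\<in>UNIV. r * (v $ j * u $ j) * g j)"
    by (simp add: qrow flip: sum_distrib_right)
  moreover have "(\<Sum>i\<in>UNIV. \<Sum>j\<in>UNIV. q i j * ln (d j)) = r * (\<Sum>j\<in>UNIV. perron_weight M j * ln (d j))"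
    by (subst sum.swap) (simp add: qcol \<pi> mult.assoc sum_distrib_left flip: sum_distrib_right)
  moreover have "(\<Sum>i\<in>UNIV. \<Sum>j\<in>UNIV. q i j * (ln r - ln s)) = r * (ln r - ln s)"
    using vu by (simp add: qrow flip: sum_distrib_right sum_distrib_left)
  ultimately have "(\<Sum>i\<in>UNIV. \<Sum>j\<in>UNIV. q i j * ln (z i j)) =
      r * (ln r - ln s + (\<Sum>j\<in>UNIV. perron_weight M j * ln (d j)))"
    unfolding lnz distrib_left[of "q _ _"] right_diff_distrib[of "q _ _" "g _"]
    by (simp add: sum.distrib sum_subtractf distrib_left)
  with le u(1) show ?thesis
    by (simp add: mult_le_0_iff r_def s_def)
qed

text \<open>The support inequality used in both directions makes \<open>ln \<rho>\<close> Lipschitz.\<close>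

lemma spectral_radius_scale_exp_continuous:
  fixes M :: "real^'n^'n"
  assumes M: "irreducible_nonneg M"
  shows "continuous_on UNIV (\<lambda>s. spectral_radius (scale_columns M (\<lambda>j. exp (s * l j))))"
proof -
  define Ms where "Ms s = scale_columns M (\<lambda>j. exp (s * l j))" for s
  define K where "K = (\<Sum>j\<in>UNIV. \<bar>l j\<bar>)"
  have K: "0 \<le> K" by (auto simp: K_def intro: sum_nonneg)
  have irr: "irreducible_nonneg (Ms s)" for s
    unfolding Ms_def by (intro irreducible_nonneg_scale_columns M) auto
  have shift: "Ms s' = scale_columns (Ms s) (\<lambda>j. exp ((s' - s) * l j))" for s s'
    by (simp add: Ms_def scale_columns_twice algebra_simps flip: exp_add)
  have le: "ln (spectral_radius (Ms s)) - K * \<bar>s' - s\<bar> \<le> ln (spectral_radius (Ms s'))" for s s'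
  proof -
    have "perron_weight (Ms s) j \<le> 1" for j
      using member_le_sum[of j UNIV "perron_weight (Ms s)"] sum_perron_weight[OF irr, of s]
        perron_weight_pos[OF irr, of s] by (simp add: less_imp_le)
    then have "\<bar>\<Sum>j\<in>UNIV. perron_weight (Ms s) j * ((s' - s) * l j)\<bar>
        \<le> (\<Sum>j\<in>UNIV. 1 * (\<bar>s' - s\<bar> * \<bar>l j\<bar>))"
      using perron_weight_pos[OF irr, of s]
      by (intro order.trans[OF sum_abs] sum_mono) 
        (auto simp: abs_mult less_imp_le intro!: mult_left_le_one_le)
    then have "- (K * \<bar>s' - s\<bar>) \<le> (\<Sum>j\<in>UNIV. perron_weight (Ms s) j * ((s' - s) * l j))"
      by (simp add: K_def sum_distrib_left mult.commute)
    also have "\<dots> \<le> ln (spectral_radius (Ms s')) - ln (spectral_radius (Ms s))"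
      using ln_spectral_radius_support[OF irr[of s], of "\<lambda>j. exp ((s' - s) * l j)"]
      unfolding shift[of s' s] by simp
    finally show ?thesis by simp
  qed
  have "K-lipschitz_on UNIV (\<lambda>s. ln (spectral_radius (Ms s)))"
  proof (rule lipschitz_onI[OF _ K])
    fix s s' show "dist (ln (spectral_radius (Ms s))) (ln (spectral_radius (Ms s'))) \<le> K * dist s s'"
      using le[of s s'] le[of s' s] by (simp add: dist_real_def abs_minus_commute abs_le_iff)
  qed
  then have "continuous_on UNIV (\<lambda>s. exp (ln (spectral_radius (Ms s))))"
    by (intro continuous_intros lipschitz_on_continuous_on)
  moreover have "0 < spectral_radius (Ms s)" for s
    by (rule spectral_radius_pos[OF irr])
  ultimately show ?thesis by (simp add: Ms_def)
qed

text \<open>The unit Perron vector is continuous in the parameter, because it is unique and so its graph is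
  closed in a compact set of vectors. Pairing the eigenvector equation at \<open>s\<close> with the left Perron
  vector at \<open>0\<close> then gives the difference quotient of \<open>\<rho>\<close> in closed form, and its limit exists.
  Differentiability is what excludes a kink of the pressure at its minimum.\<close>

theorem ln_spectral_radius_scale_exp_derivative:
  fixes M :: "real^'n^'n"
  assumes M: "irreducible_nonneg M"
  shows "((\<lambda>s. ln (spectral_radius (scale_columns M (\<lambda>j. exp (s * l j)))))
    has_real_derivative (\<Sum>j\<in>UNIV. perron_weight M j * l j)) (at 0)"
proof -
  define Ms where "Ms s = scale_columns M (\<lambda>j. exp (s * l j))" for s
  define \<rho> where "\<rho> s = spectral_radius (Ms s)" for s
  have irr: "irreducible_nonneg (Ms s)" for s
    unfolding Ms_def by (intro irreducible_nonneg_scale_columns M) auto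
  have M0: "Ms 0 = M" by (simp add: Ms_def scale_columns_one)
  have \<rho>cont: "continuous_on UNIV \<rho>"
    unfolding \<rho>_def Ms_def by (rule spectral_radius_scale_exp_continuous[OF M])
  have \<rho>pos: "0 < \<rho> s" for s
    unfolding \<rho>_def by (rule spectral_radius_pos[OF irr])
  define S :: "(real^'n) set" where "S = {x. (\<forall>i. 0 \<le> x $ i) \<and> norm x = 1}"
  have "\<exists>w. (\<forall>i. 0 < w $ i) \<and> norm w = 1 \<and> Ms s *v w = \<rho> s *\<^sub>R w" for s
    unfolding \<rho>_def by (rule perron_vectors[OF irr[of s]]) blast
  then obtain U where U: "\<And>s i. 0 < U s $ i" "\<And>s. norm (U s) = 1" "\<And>s. Ms s *v U s = \<rho> s *\<^sub>R U s"
    by metis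
  have uniq: "w = U s" if w: "w \<in> S" "Ms s *v w = \<rho> s *\<^sub>R w" for s w
  proof -
    have wnn: "0 \<le> w $ i" for i using w by (simp add: S_def)
    have "w \<noteq> 0" using w(1) by (auto simp: S_def)
    then have "0 < w $ i" for i using irreducible_nonneg_eigenvector_pos(1)[OF irr w(2) wnn] by blast
    then obtain c where "c > 0" "w = c *\<^sub>R U s"
      using perron_eigenvector_unique[OF irr _ w(2) U(1,3)] by blast
    then show ?thesis using w(1) U(2)[of s] by (auto simp: S_def)
  qed
  have "S = (\<Inter>i. {x. 0 \<le> x $ i}) \<inter> sphere 0 1" by (auto simp: S_def)
  then have "compact S"
    by (auto intro!: closed_Int_compact closed_INT closed_Collect_le continuous_intros)
  moreover have "U \<in> UNIV \<rightarrow> S" using U by (auto simp: S_def less_imp_le)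
  moreover have "closed ((\<lambda>s. (s, U s)) ` UNIV)"
  proof -
    have comp: "(Ms s *v w) $ i = (\<Sum>j\<in>UNIV. M $ i $ j * exp (s * l j) * w $ j)" for s w i
      by (simp add: Ms_def scale_columns_def matrix_vector_component)
    have US: "U s \<in> S" for s using U by (simp add: S_def less_imp_le)
    have "w = U s \<longleftrightarrow> w \<in> S \<and> Ms s *v w = \<rho> s *\<^sub>R w" for s w
      using uniq[of w s] US[of s] U(3)[of s] by blast
    then have "(\<lambda>s. (s, U s)) ` UNIV = {(s, w). w \<in> S \<and> Ms s *v w = \<rho> s *\<^sub>R w}"
      by auto
    also have "\<dots> = (UNIV \<times> S) \<inter>
        (\<Inter>i. {x. (\<Sum>j\<in>UNIV. M $ i $ j * exp (fst x * l j) * snd x $ j) = \<rho> (fst x) * snd x $ i})"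
      by (auto simp: vec_eq_iff comp)
    also have "closed \<dots>"
      using compact_imp_closed[OF \<open>compact S\<close>]
      by (intro closed_Int closed_Times closed_INT ballI closed_Collect_eq continuous_intros
          continuous_on_compose2[OF \<rho>cont]) auto
    finally show ?thesis .
  qed
  ultimately have "continuous_on UNIV U" by (rule continuous_from_closed_graph)
  then have Ulim: "U \<midarrow>0\<rightarrow> U 0" by (simp add: continuous_on_def)
  obtain u v where u: "\<And>i. 0 < u $ i" "M *v u = \<rho> 0 *\<^sub>R u" "norm u = 1"
    and v: "\<And>i. 0 < v $ i" "v v* M = \<rho> 0 *\<^sub>R v" "v \<bullet> u = 1"
    and \<pi>: "\<And>j. perron_weight M j = v $ j * u $ j"
    unfolding \<rho>_def M0 by (rule perron_vectors[OF M]) blast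
  have "u = U 0" using uniq[of u 0] u by (auto simp: S_def less_imp_le M0)
  have col: "(\<Sum>i\<in>UNIV. v $ i * M $ i $ j) = \<rho> 0 * v $ j" for j
    using arg_cong[OF v(2), of "\<lambda>y. y $ j"] by (simp add: vector_matrix_mult_def mult.commute)
  define D where "D s j = (exp (s * l j) - 1) / s" for s j
  have quot: "(\<rho> s - \<rho> 0) / s = (\<Sum>j\<in>UNIV. \<rho> 0 * v $ j * D s j * U s $ j) / (v \<bullet> U s)" if "s \<noteq> 0" for s
  proof -
    have pos: "0 < v \<bullet> U s"
      unfolding inner_vec_def using U(1) v(1) by (auto intro!: sum_pos)
    (* v is the left Perron vector at 0, U s the right one at s. *)
    have "\<rho> s * (v \<bullet> U s) = v \<bullet> (Ms s *v U s)" by (simp add: U)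
    also have "\<dots> = (\<Sum>j\<in>UNIV. (\<Sum>i\<in>UNIV. v $ i * M $ i $ j) * exp (s * l j) * U s $ j)"
      unfolding inner_vec_def Ms_def scale_columns_def matrix_vector_component
      by (simp add: sum_distrib_left sum_distrib_right mult.assoc) (rule sum.swap)
    also have "\<dots> = (\<Sum>j\<in>UNIV. \<rho> 0 * v $ j * exp (s * l j) * U s $ j)" by (simp add: col)
    finally have "(\<rho> s - \<rho> 0) * (v \<bullet> U s) = (\<Sum>j\<in>UNIV. \<rho> 0 * v $ j * (exp (s * l j) - 1) * U s $ j)"
      by (simp add: left_diff_distrib right_diff_distrib sum_subtractf inner_vec_def
          sum_distrib_left mult.assoc)
    also have "\<dots> = (\<Sum>j\<in>UNIV. \<rho> 0 * v $ j * D s j * U s $ j) * s"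
      using that by (simp add: D_def sum_distrib_right)
    finally show ?thesis using that pos by (simp add: field_simps)
  qed
  have Dlim: "((\<lambda>s. D s j) \<longlongrightarrow> l j) (at 0)" for j
  proof -
    have "((\<lambda>s. exp (s * l j)) has_real_derivative l j) (at 0)"
      by (auto intro!: derivative_eq_intros)
    then show ?thesis by (simp add: DERIV_def D_def)
  qed
  have "((\<lambda>s. (\<Sum>j\<in>UNIV. \<rho> 0 * v $ j * D s j * U s $ j) / (v \<bullet> U s)) \<longlongrightarrow>
     (\<Sum>j\<in>UNIV. \<rho> 0 * v $ j * l j * U 0 $ j) / (v \<bullet> U 0)) (at 0)"
    using v(3) \<open>u = U 0\<close> by (intro tendsto_intros Dlim Ulim) auto
  moreover have "(\<Sum>j\<in>UNIV. \<rho> 0 * v $ j * l j * U 0 $ j) / (v \<bullet> U 0) =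
     \<rho> 0 * (\<Sum>j\<in>UNIV. perron_weight M j * l j)"
    using v(3) \<open>u = U 0\<close> by (simp add: \<pi> sum_distrib_left mult_ac)
  ultimately have "((\<lambda>s. (\<rho> s - \<rho> 0) / s) \<longlongrightarrow> \<rho> 0 * (\<Sum>j\<in>UNIV. perron_weight M j * l j)) (at 0)"
    using quot by (subst LIM_equal) auto
  then have "(\<rho> has_real_derivative \<rho> 0 * (\<Sum>j\<in>UNIV. perron_weight M j * l j)) (at 0)"
    by (simp add: DERIV_def)
  then have "((\<lambda>s. ln (\<rho> s)) has_real_derivative (\<Sum>j\<in>UNIV. perron_weight M j * l j)) (at 0)"
    using \<rho>pos[of 0] by (auto intro!: derivative_eq_intros)
  then show ?thesis by (simp add: \<rho>_def Ms_def)
qed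

section \<open>Weighted sums over words of a strongly connected graph\<close>

definition edge_matrix :: "('v, 'e::finite) gifs \<Rightarrow> ('e \<Rightarrow> real) \<Rightarrow> real^'e^'e" where
  "edge_matrix G m = (\<chi> e e'. if ter G e = ini G e' then m e' else 0)"

lemma irreducible_nonneg_edge_matrix:
  assumes sc: "strongly_connected G" and m: "\<And>e. 0 < m e"
  shows "irreducible_nonneg (edge_matrix G m)"
proof -
  define R where "R = {(e, e'). ter G e = ini G e'}"
  have word: "(e, last w) \<in> R\<^sup>+"
    if "w \<noteq> []" "successively (\<lambda>e e'. ter G e = ini G e') w" "ter G e = ini G (hd w)" for e w
    using that
  proof (induction w arbitrary: e)
    case (Cons e' w)
    have edge: "(e, e') \<in> R" using Cons.prems by (simp add: R_def)
    show ?case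
    proof (cases "w = []")
      case False
      then have "(e', last w) \<in> R\<^sup>+" using Cons by (auto simp: successively_Cons)
      then show ?thesis using edge False by (simp add: trancl_into_trancl2)
    qed (use edge in auto)
  qed simp
  have "(e, e') \<in> R\<^sup>+" for e e'
  proof -
    obtain k w where kw: "k \<ge> 1" "w \<in> words G k" "joins G (ter G e) w (ini G e')"
      using sc unfolding strongly_connected_def by blast
    then have "w \<noteq> []" by (auto simp: words_def)
    then have "(e, last w) \<in> R\<^sup>+" using word[of w e] kw by (simp add: words_def joins_def)
    moreover have "(last w, e') \<in> R" using kw(3) by (simp add: joins_def R_def)
    ultimately show ?thesis by (rule trancl_into_trancl)
  qed
  moreover have "{(e, e'). 0 < edge_matrix G m $ e $ e'} = R"
    using m by (auto simp: edge_matrix_def R_def)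
  ultimately show ?thesis
    using m by (simp add: irreducible_nonneg_def) (simp add: edge_matrix_def less_imp_le)
qed

lemma finite_words: "finite (words G k :: 'e::finite list set)"
  by (rule finite_subset[OF _ finite_lists_length_eq[of "UNIV :: 'e set" k]])
    (auto simp: words_def)

lemma words_one: "words G (Suc 0) = range (\<lambda>e. [e])"
  by (auto simp: words_def length_Suc_conv)

text \<open>Words are extended at their end, so that the right eigenvector equation of the edge matrix,
  which sums over the successors of an edge, can be applied to the last letter.\<close>

lemma sum_words_snoc:
  fixes f :: "'e::finite list \<Rightarrow> real"
  assumes "0 < k"
  shows "(\<Sum>w\<in>words G (Suc k). f w) = (\<Sum>w\<in>words G k. \<Sum>e\<in>{e. ter G (last w) = ini G e}. f (w @ [e]))"
proof -
  have "(\<Sum>w\<in>words G k. \<Sum>e\<in>{e. ter G (last w) = ini G e}. f (w @ [e])) =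
      (\<Sum>z\<in>(SIGMA w:words G k. {e. ter G (last w) = ini G e}). f (fst z @ [snd z]))"
    by (subst sum.Sigma) (auto simp: finite_words case_prod_beta)
  also have "\<dots> = (\<Sum>w\<in>words G (Suc k). f w)"
  proof (rule sum.reindex_bij_witness[of _ "\<lambda>w. (butlast w, last w)" "\<lambda>z. fst z @ [snd z]"])
    fix w assume w: "w \<in> words G (Suc k)"
    then have "w \<noteq> []" by (auto simp: words_def)
    then obtain w' e where we: "w = w' @ [e]" by (metis append_butlast_last_id)
    have "w' \<noteq> []" using w assms we by (auto simp: words_def)
    then show "(butlast w, last w) \<in> (SIGMA w:words G k. {e. ter G (last w) = ini G e})"
      using w we by (auto simp: words_def successively_append_iff)
    show "fst (butlast w, last w) @ [snd (butlast w, last w)] = w" using we by simp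
  next
    fix z assume "z \<in> (SIGMA w:words G k. {e. ter G (last w) = ini G e})"
    then show "fst z @ [snd z] \<in> words G (Suc k)"
      by (auto simp: words_def successively_append_iff)
  qed auto
  finally show ?thesis by simp
qed

lemma word_prod_simps [simp]:
  "word_prod c [] = 1" "word_prod c (e # w) = c e * word_prod c w"
  "word_prod c (w @ w') = word_prod c w * word_prod c w'"
  by (simp_all add: word_prod_def)

lemma word_prod_pos: "(\<And>e. 0 < c e) \<Longrightarrow> 0 < word_prod c w"
  by (induction w) auto

text \<open>With the right Perron vector \<open>u\<close> attached to the last letter, the weighted sum over words of
  length \<open>k\<close> is multiplied by exactly \<open>r\<close> when \<open>k\<close> increases by one. Removing \<open>u\<close> costs only constant
  factors.\<close>

lemma word_sum_growth:
  fixes G :: "('v, 'e::finite) gifs"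
  assumes sc: "strongly_connected G" and m: "\<And>e. 0 < m e"
  obtains c C where "0 < c" "0 < C"
    "\<And>k. 0 < k \<Longrightarrow> c * spectral_radius (edge_matrix G m) ^ k \<le> (\<Sum>w\<in>words G k. word_prod m w)"
    "\<And>k. 0 < k \<Longrightarrow> (\<Sum>w\<in>words G k. word_prod m w) \<le> C * spectral_radius (edge_matrix G m) ^ k"
proof -
  define r where "r = spectral_radius (edge_matrix G m)"
  obtain u where r: "0 < r" and u: "\<And>i. 0 < u $ i" "edge_matrix G m *v u = r *\<^sub>R u"
    unfolding r_def by (rule perron_vectors[OF irreducible_nonneg_edge_matrix[of G m, OF sc m]]) blast
  define T where "T k = (\<Sum>w\<in>words G k. word_prod m w * u $ last w)" for k
  have step: "(\<Sum>e'\<in>{e'. ter G e = ini G e'}. m e' * u $ e') = r * u $ e" for e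
    using arg_cong[OF u(2), of "\<lambda>y. y $ e"]
    by (simp add: matrix_vector_component edge_matrix_def if_distrib[of "\<lambda>x. x * _"] sum.If_cases cong: if_cong)
  have T: "T (Suc k) = r ^ k * T 1" for k
  proof (induction k)
    case (Suc k)
    have "T (Suc (Suc k)) = (\<Sum>w\<in>words G (Suc k). word_prod m w * (r * u $ last w))"
      unfolding T_def sum_words_snoc[OF zero_less_Suc] step[symmetric]
      by (simp add: sum_distrib_left mult.assoc)
    also have "\<dots> = r * T (Suc k)" by (simp add: T_def sum_distrib_left mult_ac)
    finally show ?case by (simp add: Suc mult_ac)
  qed simp
  have T1: "0 < T 1"
  proof -
    have "T 1 = (\<Sum>e\<in>UNIV. m e * u $ e)"
      by (simp add: T_def words_one sum.reindex inj_def)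
    also have "\<dots> > 0" using m u by (intro sum_pos) auto
    finally show ?thesis .
  qed
  define lo hi where "lo = Min (range (($) u))" and "hi = Max (range (($) u))"
  have lohi: "lo \<le> u $ e" "u $ e \<le> hi" for e by (auto simp: lo_def hi_def)
  have lo: "0 < lo" using u(1) by (auto simp: lo_def)
  have hi: "0 < hi" using lo lohi[of undefined] by linarith
  have Tk: "T k = T 1 / r * r ^ k" if "0 < k" for k
    using T[of "k - 1"] that r by (cases k) auto
  have wp: "0 \<le> word_prod m w" for w using word_prod_pos[of m, OF m] by (simp add: less_imp_le)
  show ?thesis
  proof (rule that[of "T 1 / r / hi" "T 1 / r / lo"])
    fix k :: nat assume k: "0 < k"
    have "T k \<le> (\<Sum>w\<in>words G k. word_prod m w * hi)"
      unfolding T_def by (intro sum_mono mult_left_mono lohi wp)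
    then have "T 1 / r * r ^ k \<le> (\<Sum>w\<in>words G k. word_prod m w) * hi"
      by (simp only: Tk[OF k] sum_distrib_right)
    then show "T 1 / r / hi * spectral_radius (edge_matrix G m) ^ k \<le> (\<Sum>w\<in>words G k. word_prod m w)"
      using divide_right_mono[OF _ less_imp_le[OF hi]] hi by (fastforce simp: r_def)
    have "(\<Sum>w\<in>words G k. word_prod m w * lo) \<le> T k"
      unfolding T_def by (intro sum_mono mult_left_mono lohi wp)
    then have "(\<Sum>w\<in>words G k. word_prod m w) * lo \<le> T 1 / r * r ^ k"
      by (simp only: Tk[OF k] sum_distrib_right)
    then show "(\<Sum>w\<in>words G k. word_prod m w) \<le> T 1 / r / lo * spectral_radius (edge_matrix G m) ^ k"
      using divide_right_mono[OF _ less_imp_le[OF lo]] lo by (fastforce simp: r_def)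
  qed (use T1 r lo hi in auto)
qed

text \<open>The lower bound may lose an arbitrarily small exponential rate, which is what the large
  deviation estimate for the pressure provides.\<close>

lemma root_tendsto_exp:
  fixes S :: "nat \<Rightarrow> real"
  assumes up: "\<And>k. 0 < k \<Longrightarrow> S k \<le> C * exp (real k * H)"
    and lo: "\<And>\<epsilon>::real. 0 < \<epsilon> \<Longrightarrow>
      \<exists>c>0. eventually (\<lambda>k. c * exp (real k * (H - \<epsilon>)) \<le> S k) sequentially"
  shows "(\<lambda>k. root k (S k)) \<longlonglongrightarrow> exp H"
proof -
  have small: "eventually (\<lambda>k. \<bar>ln c / real k\<bar> < e) sequentially" if "0 < e" for c e :: real
  proof -
    have "(\<lambda>k. ln c / real k) \<longlonglongrightarrow> 0" by (rule lim_const_over_n)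
    from tendstoD[OF this that] show ?thesis by (simp add: dist_real_def)
  qed
  obtain c1 where c1: "0 < c1" "eventually (\<lambda>k. c1 * exp (k * (H - 1)) \<le> S k) sequentially"
    using lo[of 1] by auto
  have pos: "eventually (\<lambda>k. 0 < S k \<and> 0 < k) sequentially"
    using c1(2) eventually_gt_at_top[of 0]
    by eventually_elim (use c1(1) in \<open>smt (verit) exp_gt_zero mult_pos_pos\<close>)
  have C: "0 < C"
  proof -
    obtain k where "0 < S k" "0 < k" using eventually_happens'[OF _ pos] by auto
    then have "0 < C * exp (k * H)" using up[of k] by simp
    then show ?thesis by (simp add: zero_less_mult_iff)
  qed
  have "(\<lambda>k. ln (S k) / k) \<longlonglongrightarrow> H"
  proof (rule tendstoI)
    fix e :: real assume e: "0 < e"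
    obtain c where c: "0 < c" "eventually (\<lambda>k. c * exp (k * (H - e / 2)) \<le> S k) sequentially"
      using lo[of "e / 2"] e by auto
    show "eventually (\<lambda>k. dist (ln (S k) / k) H < e) sequentially"
      using c(2) pos small[OF e, of C] small[OF half_gt_zero[OF e], of c]
    proof eventually_elim
      case (elim k)
      then have k: "0 < real k" and S: "0 < S k" by auto
      have "ln (S k) \<le> ln (C * exp (k * H))"
        using up[of k] k S by simp
      also have "\<dots> = ln C + k * H" using C by (simp add: ln_mult)
      finally have 1: "ln (S k) / k \<le> ln C / k + H"
        using k by (simp add: field_simps)
      have "ln (c * exp (k * (H - e / 2))) \<le> ln (S k)"
        using elim(1) c(1) S by simp
      then have "ln c + k * (H - e / 2) \<le> ln (S k)" using c(1) by (simp add: ln_mult)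
      then have 2: "ln c / k + (H - e / 2) \<le> ln (S k) / k"
        using divide_right_mono[of _ _ "real k"] k by (fastforce simp: add_divide_distrib)
      show ?case
        using 1 2 elim(3,4) unfolding dist_real_def abs_less_iff by linarith
    qed
  qed
  then have "(\<lambda>k. exp (ln (S k) / k)) \<longlonglongrightarrow> exp H" by (intro tendsto_intros)
  moreover have "eventually (\<lambda>k. exp (ln (S k) / k) = root k (S k)) sequentially"
    using pos by eventually_elim (simp add: root_powr_inverse powr_def)
  ultimately show ?thesis by (rule Lim_transform_eventually)
qed

section \<open>The level curve of a convex decreasing function of two variables\<close>

text \<open>\<open>h x y\<close> stands for the logarithm of \<open>\<rho> (F x y)\<close>, and \<open>(A x y, B x y)\<close> for the slope of
  its supporting plane.
  Supporting planes with both slopes bounded away from zero carry the global information: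
  convexity, strict decrease and the existence of a unique zero on each vertical and horizontal
  line. The derivative in the direction \<open>(1, -1)\<close> describes \<open>h\<close> along the lines \<open>x + y = s\<close>.\<close>

locale pressure_plane =
  fixes h A B :: "real \<Rightarrow> real \<Rightarrow> real" and \<kappa> K :: real
  assumes support: "h x y + (x' - x) * A x y + (y' - y) * B x y \<le> h x' y'"
    and slope_A: "- K \<le> A x y" "A x y \<le> - \<kappa>"
    and slope_B: "- K \<le> B x y" "B x y \<le> - \<kappa>"
    and \<kappa>: "0 < \<kappa>"
    and derivative: "((\<lambda>s. h (x + s) (y - s)) has_real_derivative (A x y - B x y)) (at 0)"
begin

lemma K_pos: "0 < K"
  using slope_A[of 0 0] \<kappa> by linarith

lemma decrease_x: "x \<le> x' \<Longrightarrow> h x' y \<le> h x y - \<kappa> * (x' - x)"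
  using support[of x' y x y] mult_left_mono[OF slope_A(2)[of x' y], of "x' - x"]
  by (simp add: algebra_simps)

lemma decrease_y: "y \<le> y' \<Longrightarrow> h x y' \<le> h x y - \<kappa> * (y' - y)"
  using support[of x y' x y] mult_left_mono[OF slope_B(2)[of x y'], of "y' - y"]
  by (simp add: algebra_simps)

lemma less_x: "x < x' \<Longrightarrow> h x' y < h x y"
  using decrease_x[of x x' y] mult_pos_pos[OF \<kappa>, of "x' - x"] by linarith

lemma less_y: "y < y' \<Longrightarrow> h x y' < h x y"
  using decrease_y[of y y' x] mult_pos_pos[OF \<kappa>, of "y' - y"] by linarith

lemma le_x_iff: "h x' y \<le> h x y \<longleftrightarrow> x \<le> x'"
proof
  assume le: "h x' y \<le> h x y"
  show "x \<le> x'"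
  proof (rule ccontr)
    assume "\<not> x \<le> x'"
    then have "x' < x" by simp
    from less_x[OF this] le show False by (simp add: not_le[symmetric])
  qed
next
  assume "x \<le> x'"
  then show "h x' y \<le> h x y"
    using less_x[THEN less_imp_le] by (metis order.order_iff_strict)
qed

lemma le_y_iff: "h x y' \<le> h x y \<longleftrightarrow> y \<le> y'"
proof
  assume le: "h x y' \<le> h x y"
  show "y \<le> y'"
  proof (rule ccontr)
    assume "\<not> y \<le> y'"
    then have "y' < y" by simp
    from less_y[OF this] le show False by (simp add: not_le[symmetric])
  qed
next
  assume "y \<le> y'"
  then show "h x y' \<le> h x y"
    using less_y[THEN less_imp_le] by (metis order.order_iff_strict)
qed

lemma eq_x_iff: "h x' y = h x y \<longleftrightarrow> x = x'"
  unfolding order.eq_iff[of "h x' y"] le_x_iff by linarith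

lemma eq_y_iff: "h x y' = h x y \<longleftrightarrow> y = y'"
  unfolding order.eq_iff[of "h x y'"] le_y_iff by linarith

lemma continuous: "continuous_on UNIV (\<lambda>z. h (fst z) (snd z))"
proof -
  have le: "h (fst z) (snd z) - h (fst w) (snd w) \<le> (2 * K) * dist z w" for z w :: "real \<times> real"
  proof -
    have product: "a * c \<le> \<bar>a\<bar> * K" if "- K \<le> c" "c \<le> - \<kappa>" for a c
    proof -
      have "\<bar>c\<bar> \<le> K" using that \<kappa> by linarith
      then have "\<bar>a\<bar> * \<bar>c\<bar> \<le> \<bar>a\<bar> * K" by (rule mult_left_mono) simp
      then show ?thesis using abs_ge_self[of "a * c"] unfolding abs_mult by linarith
    qed
    have "(fst z - fst w) * A (fst z) (snd z) + (snd z - snd w) * B (fst z) (snd z)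
        \<le> \<bar>fst z - fst w\<bar> * K + \<bar>snd z - snd w\<bar> * K"
      by (intro add_mono product slope_A slope_B)
    also have "\<dots> \<le> dist z w * K + dist z w * K"
      using dist_fst_le[of z w] dist_snd_le[of z w] K_pos
      by (intro add_mono mult_right_mono) (auto simp: dist_real_def)
    finally show ?thesis
      using support[of "fst z" "snd z" "fst w" "snd w"] by (simp add: algebra_simps)
  qed
  have "(2 * K)-lipschitz_on UNIV (\<lambda>z. h (fst z) (snd z))"
  proof (rule lipschitz_onI)
    fix z w :: "real \<times> real"
    show "dist (h (fst z) (snd z)) (h (fst w) (snd w)) \<le> (2 * K) * dist z w"
      using le[of z w] le[of w z] by (simp add: dist_real_def dist_commute abs_le_iff)
  qed (use K_pos in simp)
  then show ?thesis by (rule lipschitz_on_continuous_on)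
qed

lemma continuous_compose:
  "continuous_on S f \<Longrightarrow> continuous_on S g \<Longrightarrow> continuous_on S (\<lambda>s. h (f s) (g s))"
  using continuous_on_compose2[OF continuous, of S "\<lambda>s. (f s, g s)"]
  by (auto intro: continuous_intros)

text \<open>The linear decrease with rate at least \<open>\<kappa>\<close> locates a sign change within distance \<open>\<bar>h x 0\<bar> / \<kappa>\<close>
  of zero.\<close>

lemma ex1_zero_y: "\<exists>!y. h x y = 0"
proof -
  define N where "N = \<bar>h x 0\<bar> / \<kappa>"
  have N: "0 \<le> N" "\<kappa> * N = \<bar>h x 0\<bar>" using \<kappa> by (auto simp: N_def)
  have "h x N \<le> 0" using decrease_y[of 0 N x] N by auto
  moreover have "0 \<le> h x (- N)" using decrease_y[of "- N" 0 x] N by auto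
  ultimately obtain y where "h x y = 0"
    using IVT2'[of "h x" N 0 "- N"] N continuous_compose[of "{-N..N}" "\<lambda>_. x" "\<lambda>y. y"]
    by (auto intro: continuous_intros)
  then show ?thesis using eq_y_iff by metis
qed

lemma ex1_zero_x: "\<exists>!x. h x y = 0"
proof -
  define N where "N = \<bar>h 0 y\<bar> / \<kappa>"
  have N: "0 \<le> N" "\<kappa> * N = \<bar>h 0 y\<bar>" using \<kappa> by (auto simp: N_def)
  have "h N y \<le> 0" using decrease_x[of 0 N y] N by auto
  moreover have "0 \<le> h (- N) y" using decrease_x[of "- N" 0 y] N by auto
  ultimately obtain x where "h x y = 0"
    using IVT2'[of "\<lambda>x. h x y" N 0 "- N"] N continuous_compose[of "{-N..N}" "\<lambda>x. x" "\<lambda>_. y"]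
    by (auto intro: continuous_intros)
  then show ?thesis using eq_x_iff by metis
qed

lemma antidiagonal_derivative:
  "((\<lambda>r. h r (s - r)) has_real_derivative (A x (s - x) - B x (s - x))) (at x)"
  using derivative[of x "s - x"] DERIV_shift[of "\<lambda>r. h r (s - r)" _ 0 x]
  by (simp add: algebra_simps)

lemma antidiagonal_support: "h x (s - x) + (x' - x) * (A x (s - x) - B x (s - x)) \<le> h x' (s - x')"
  using support[of x "s - x" x' "s - x'"] by (simp add: algebra_simps)

lemma antidiagonal_minimizer:
  assumes "a \<le> b"
  obtains x0 where "x0 \<in> {a..b}" "\<And>x. x \<in> {a..b} \<Longrightarrow> h x0 (s - x0) \<le> h x (s - x)"
proof -
  have "continuous_on {a..b} (\<lambda>x. h x (s - x))"
    by (rule continuous_compose) (intro continuous_intros)+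
  then show ?thesis
    using continuous_attains_inf[of "{a..b}" "\<lambda>x. h x (s - x)"] assms that by auto
qed

lemma antidiagonal_slope_nonneg:
  assumes "x < b" and min: "\<And>x'. x < x' \<Longrightarrow> x' < b \<Longrightarrow> h x (s - x) \<le> h x' (s - x')"
  shows "0 \<le> A x (s - x) - B x (s - x)"
proof (rule ccontr)
  assume "\<not> ?thesis"
  then obtain d where d: "0 < d" "\<And>e. 0 < e \<Longrightarrow> e < d \<Longrightarrow> h (x + e) (s - (x + e)) < h x (s - x)"
    using DERIV_neg_dec_right[OF antidiagonal_derivative[of s x]] by force
  define e where "e = min (d / 2) ((b - x) / 2)"
  have "0 < e" "e < d" "x + e < b" using d(1) assms(1) by (auto simp: e_def min_def field_simps)
  then show False using d(2)[of e] min[of "x + e"] by fastforce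
qed

lemma antidiagonal_slope_nonpos:
  assumes "a < x" and min: "\<And>x'. a < x' \<Longrightarrow> x' < x \<Longrightarrow> h x (s - x) \<le> h x' (s - x')"
  shows "A x (s - x) - B x (s - x) \<le> 0"
proof (rule ccontr)
  assume "\<not> ?thesis"
  then obtain d where d: "0 < d" "\<And>e. 0 < e \<Longrightarrow> e < d \<Longrightarrow> h (x - e) (s - (x - e)) < h x (s - x)"
    using DERIV_pos_inc_left[OF antidiagonal_derivative[of s x]] by force
  define e where "e = min (d / 2) ((x - a) / 2)"
  have "0 < e" "e < d" "a < x - e" using d(1) assms(1) by (auto simp: e_def min_def field_simps)
  then show False using d(2)[of e] min[of "x - e"] by fastforce
qed

end

text \<open>\<open>P\<close> is the pressure as a function of \<open>s\<close>. On the line \<open>x + y = s\<close> the two points with \<open>x = tA\<close> and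
  with \<open>y = tB\<close> pass each other at \<open>s = tA + tB\<close>. Below this value the larger of the two growth
  rates prevails, above it the smallest rate on the segment between the two points.
  Each of \<open>gA\<close> and \<open>gB\<close> is the sum of the coordinates of a point of the curve \<open>h = 0\<close>, on the
  vertical line \<open>x = tA\<close> and on the horizontal line \<open>y = tB\<close>.\<close>

locale pressure_equation = pressure_plane +
  fixes tA tB gA gB :: real and P :: "real \<Rightarrow> real"
  assumes gA_zero: "h tA (gA - tA) = 0" and gB_zero: "h (gB - tB) tB = 0"
    and P_below: "s \<le> tA + tB \<Longrightarrow> P s = exp (max (h tA (s - tA)) (h (s - tB) tB))"
    and P_above: "tA + tB \<le> s \<Longrightarrow> x0 \<in> {tA..s - tB} \<Longrightarrow>
      (\<And>x. x \<in> {tA..s - tB} \<Longrightarrow> h x0 (s - x0) \<le> h x (s - x)) \<Longrightarrow> P s = exp (h x0 (s - x0))"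
begin

lemma gA_le_iff: "gA \<le> tA + tB \<longleftrightarrow> h tA tB \<le> 0"
  using le_y_iff[of tA tB "gA - tA"] gA_zero by auto

lemma gB_le_iff: "gB \<le> tA + tB \<longleftrightarrow> h tA tB \<le> 0"
  using le_x_iff[of tA tB "gB - tB"] gB_zero by auto

lemma gA_ge_iff: "tA + tB \<le> gA \<longleftrightarrow> 0 \<le> h tA tB"
  using le_y_iff[of tA "gA - tA" tB] gA_zero by auto

lemma gB_ge_iff: "tA + tB \<le> gB \<longleftrightarrow> 0 \<le> h tA tB"
  using le_x_iff[of "gB - tB" tB tA] gB_zero by auto

text \<open>Both comparisons are decided by the sign of \<open>h\<close> at the corner \<open>(tA, tB)\<close>.\<close>

lemma dichotomy: "max gA gB \<le> tA + tB \<or> tA + tB \<le> min gA gB"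
  using gA_le_iff gB_le_iff gA_ge_iff gB_ge_iff by auto

lemma P_above_minimizer:
  assumes "tA + tB \<le> s"
  obtains x0 where "x0 \<in> {tA..s - tB}" "P s = exp (h x0 (s - x0))"
    "\<And>x. x \<in> {tA..s - tB} \<Longrightarrow> h x0 (s - x0) \<le> h x (s - x)"
proof -
  have "tA \<le> s - tB" using assms by simp
  then obtain x0 where x0: "x0 \<in> {tA..s - tB}" "\<And>x. x \<in> {tA..s - tB} \<Longrightarrow> h x0 (s - x0) \<le> h x (s - x)"
    using antidiagonal_minimizer[of tA "s - tB" s] by blast
  then show ?thesis using that P_above[OF assms x0] by blast
qed

text \<open>For \<open>s \<le> tA + tB\<close> the pressure is one exactly if the larger of the two strictly decreasing
  rates vanishes; beyond \<open>tA + tB\<close> it stays below one.\<close>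

lemma root_below:
  assumes "max gA gB \<le> tA + tB"
  shows "(THE s. P s = 1) = max gA gB"
proof (rule the_equality)
  let ?g = "max gA gB"
  have "h tA (?g - tA) \<le> 0" using le_y_iff[of tA "?g - tA" "gA - tA"] gA_zero by simp
  moreover have "h (?g - tB) tB \<le> 0" using le_x_iff[of "?g - tB" tB "gB - tB"] gB_zero by simp
  moreover have "h tA (?g - tA) = 0 \<or> h (?g - tB) tB = 0" using gA_zero gB_zero by (auto simp: max_def)
  ultimately show "P ?g = 1" using P_below[OF assms] by (auto simp: max_def)
next
  fix s assume s: "P s = 1"
  let ?g = "max gA gB"
  show "s = ?g"
  proof (cases "s \<le> tA + tB")
    case True
    then have max0: "max (h tA (s - tA)) (h (s - tB) tB) = 0" using s P_below[OF True] by simp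
    then have "h tA (s - tA) \<le> h tA (gA - tA)" "h (s - tB) tB \<le> h (gB - tB) tB"
      unfolding gA_zero gB_zero by (auto simp: max_def split: if_splits)
    then have "?g \<le> s" unfolding le_x_iff le_y_iff by simp
    moreover have "h tA (s - tA) = h tA (gA - tA) \<or> h (s - tB) tB = h (gB - tB) tB"
      using max0 unfolding gA_zero gB_zero by (auto simp: max_def split: if_splits)
    then have "s = gA \<or> s = gB" unfolding eq_x_iff eq_y_iff by auto
    ultimately show ?thesis by auto
  next
    case False
    then have "tA + tB \<le> s" by simp
    then obtain x0 where x0: "P s = exp (h x0 (s - x0))"
       "\<And>x. x \<in> {tA..s - tB} \<Longrightarrow> h x0 (s - x0) \<le> h x (s - x)"
      using P_above_minimizer[of s] by blast
    have "h x0 (s - x0) \<le> h tA (s - tA)" using x0(2)[of tA] False by simp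
    also have "\<dots> < h tA tB" using less_y[of tB "s - tA" tA] False by simp
    also have "\<dots> \<le> 0" using assms gA_le_iff by simp
    finally show ?thesis using s x0(1) by simp
  qed
qed

text \<open>The curve \<open>h = 0\<close> is convex, so on the arc between its points over \<open>tA\<close> and at height \<open>tB\<close> the
  sum \<open>x + y\<close> is largest at an end. If it exceeded both end values at some point, the supporting
  plane there would need a slope \<open>A - B\<close> of both signs.\<close>

lemma below_is_maximum:
  assumes le: "max gA gB \<le> tA + tB"
  shows "is_maximum {x + y | x y. h x y = 0 \<and> gB - tB \<le> x \<and> x \<le> tA} (max gA gB)"
    and "is_maximum {x + y | x y. h x y = 0 \<and> gA - tA \<le> y \<and> y \<le> tB} (max gA gB)"
proof -
  have bound: "x + y \<le> max gA gB" if xy: "h x y = 0" "gB - tB \<le> x" "x \<le> tA" for x y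
  proof (rule ccontr)
    assume "\<not> ?thesis"
    then have gt: "gA < x + y" "gB < x + y" by auto
    have "(tA - x) * A x y + (gA - tA - y) * B x y \<le> 0"
      using support[of x y tA "gA - tA"] xy gA_zero by simp
    moreover have "(gA - tA - y) * B x y > (x - tA) * B x y"
      using gt \<kappa> slope_B(2)[of x y] by (intro mult_strict_right_mono_neg) auto
    ultimately have 1: "(tA - x) * (A x y - B x y) < 0" by (simp add: algebra_simps)
    have "(gB - tB - x) * A x y + (tB - y) * B x y \<le> 0"
      using support[of x y "gB - tB" tB] xy gB_zero by simp
    moreover have "(tB - y) * B x y > (x - (gB - tB)) * B x y"
      using gt \<kappa> slope_B(2)[of x y] by (intro mult_strict_right_mono_neg) auto
    ultimately have 2: "(gB - tB - x) * (A x y - B x y) < 0" by (simp add: algebra_simps)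
    show False using 1 2 xy by (auto simp: mult_less_0_iff)
  qed
  have "\<exists>x y. max gA gB = x + y \<and> h x y = 0 \<and> gB - tB \<le> x \<and> x \<le> tA \<and> gA - tA \<le> y \<and> y \<le> tB"
  proof (cases "gA \<le> gB")
    case True
    then show ?thesis using gB_zero le by (intro exI[of _ "gB - tB"] exI[of _ tB]) auto
  next
    case False
    then show ?thesis using gA_zero le by (intro exI[of _ tA] exI[of _ "gA - tA"]) auto
  qed
  moreover have "gB - tB \<le> x \<and> x \<le> tA" if "h x y = 0" "gA - tA \<le> y" "y \<le> tB" for x y
  proof
    have "h x tB \<le> h x y" "h x y \<le> h x (gA - tA)" using that(2,3) by (simp_all only: le_y_iff)
    then have "h x tB \<le> h (gB - tB) tB" "h tA (gA - tA) \<le> h x (gA - tA)" using that(1) gA_zero gB_zero by simp_all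
    then show "gB - tB \<le> x" "x \<le> tA" by (simp_all add: le_x_iff)
  qed
  ultimately show "is_maximum {x + y | x y. h x y = 0 \<and> gB - tB \<le> x \<and> x \<le> tA} (max gA gB)"
    "is_maximum {x + y | x y. h x y = 0 \<and> gA - tA \<le> y \<and> y \<le> tB} (max gA gB)"
    unfolding is_maximum_def using bound by blast+
qed

text \<open>The curve \<open>h = 0\<close> is decreasing, so a bound on one coordinate is a bound on the other. Hence
  the two descriptions of the arc, by \<open>x\<close> and by \<open>y\<close>, agree.\<close>

lemma above_box:
  assumes "h x y = 0"
  shows "x \<le> gB - tB \<longleftrightarrow> tB \<le> y" and "y \<le> gA - tA \<longleftrightarrow> tA \<le> x"
proof -
  have "x \<le> gB - tB \<longleftrightarrow> h x y \<le> h x tB"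
    using le_x_iff[of "gB - tB" tB x] gB_zero assms by simp
  then show "x \<le> gB - tB \<longleftrightarrow> tB \<le> y" by (simp add: le_y_iff)
  have "y \<le> gA - tA \<longleftrightarrow> h x y \<le> h tA y"
    using le_y_iff[of tA "gA - tA" y] gA_zero assms by simp
  then show "y \<le> gA - tA \<longleftrightarrow> tA \<le> x" by (simp add: le_x_iff)
qed

text \<open>Let \<open>s0\<close> be the least value of \<open>x + y\<close> on the compact arc \<open>\<Gamma>\<close>. On the segment of the line
  \<open>x + y = s0\<close> with \<open>x \<ge> tA\<close> and \<open>y \<ge> tB\<close>, \<open>h\<close> is nonnegative, since otherwise the arc would contain a point
  with a smaller sum, and it vanishes at the minimizer; so the pressure at \<open>s0\<close> is one. For other
  values of \<open>s\<close> strict monotonicity of \<open>h\<close> makes the pressure different from one.\<close>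

lemma root_above:
  assumes ge: "tA + tB \<le> min gA gB"
  obtains x0 y0 where "(THE s. P s = 1) = x0 + y0" "h x0 y0 = 0" "tA \<le> x0" "tB \<le> y0"
    "\<And>x y. h x y = 0 \<Longrightarrow> tA \<le> x \<Longrightarrow> tB \<le> y \<Longrightarrow> x0 + y0 \<le> x + y"
proof -
  define \<Gamma> where "\<Gamma> = {z. h (fst z) (snd z) = 0} \<inter> ({tA..gB - tB} \<times> {tB..gA - tA})"
  have \<Gamma>: "(x, y) \<in> \<Gamma> \<longleftrightarrow> h x y = 0 \<and> tA \<le> x \<and> tB \<le> y" for x y
    using above_box[of x y] by (auto simp: \<Gamma>_def)
  have "compact \<Gamma>"
    unfolding \<Gamma>_def
    by (intro closed_Int_compact closed_Collect_eq continuous continuous_intros compact_Times) auto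
  moreover have "(gB - tB, tB) \<in> \<Gamma>" using gB_zero ge by (simp add: \<Gamma>)
  moreover have "continuous_on \<Gamma> (\<lambda>z. fst z + snd z)" by (intro continuous_intros)
  ultimately obtain z0 where z0: "z0 \<in> \<Gamma>" "\<And>z. z \<in> \<Gamma> \<Longrightarrow> fst z0 + snd z0 \<le> fst z + snd z"
    using continuous_attains_inf[of \<Gamma> "\<lambda>z. fst z + snd z"] by blast
  obtain x0 y0 where z: "z0 = (x0, y0)" by (cases z0)
  have x0: "h x0 y0 = 0" "tA \<le> x0" "tB \<le> y0" using z0(1) unfolding z \<Gamma> by auto
  have min: "x0 + y0 \<le> x + y" if "h x y = 0" "tA \<le> x" "tB \<le> y" for x y
    using z0(2)[of "(x, y)"] that by (simp add: \<Gamma> z)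
  define s0 where "s0 = x0 + y0"
  have s0: "tA + tB \<le> s0" using x0 by (simp add: s0_def)
  have "h x0 (s0 - x0) \<le> h x (s0 - x)" if x: "x \<in> {tA..s0 - tB}" for x
  proof (rule ccontr)
    assume "\<not> ?thesis"
    then have neg: "h x (s0 - x) < 0" using x0(1) by (simp add: s0_def)
    obtain y where y: "h x y = 0" using ex1_zero_y by blast
    then have ylt: "y < s0 - x" using neg le_y_iff[of x y "s0 - x"] by simp
    show False
    proof (cases "tB \<le> y")
      case True
      then show False using min[of x y] x y ylt by (simp add: s0_def)
    next
      case False
      then have "gB - tB < x" using above_box(1)[OF y] by simp
      moreover have "s0 \<le> gB" using min[of "gB - tB" tB] gB_zero ge by (simp add: s0_def)
      ultimately show False using x by simp
    qed
  qed
  then have "P s0 = exp (h x0 (s0 - x0))"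
    using P_above[OF s0, of x0] x0 by (simp add: s0_def)
  then have Ps0: "P s0 = 1" using x0(1) by (simp add: s0_def)
  have "s = s0" if s: "P s = 1" for s
  proof (cases "s < tA + tB")
    case True
    have "0 \<le> h tA tB" using ge gA_ge_iff by simp
    also have "\<dots> < h tA (s - tA)" using less_y[of "s - tA" tB tA] True by simp
    also have "\<dots> \<le> max (h tA (s - tA)) (h (s - tB) tB)" by simp
    finally show ?thesis using s P_below[of s] True by simp
  next
    case False
    then have ge': "tA + tB \<le> s" by simp
    obtain x1 where x1: "x1 \<in> {tA..s - tB}" "P s = exp (h x1 (s - x1))"
       "\<And>x. x \<in> {tA..s - tB} \<Longrightarrow> h x1 (s - x1) \<le> h x (s - x)"
      using P_above_minimizer[OF ge'] by blast
    have hx1: "h x1 (s - x1) = 0" using x1(2) s by simp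
    have "s0 \<le> s" using min[OF hx1] x1(1) by (simp add: s0_def)
    moreover have "\<not> s0 < s"
    proof
      (* The minimizer of the arc, moved up to the line x + y = s, would have a negative value of h. *)
      assume less: "s0 < s"
      then have "h x1 (s - x1) \<le> h x0 (s - x0)" using x1(3)[of x0] x0 by (simp add: s0_def)
      also have "\<dots> < h x0 y0" using less_y[of y0 "s - x0" x0] less by (simp add: s0_def)
      finally show False using hx1 x0(1) by simp
    qed
    ultimately show ?thesis by simp
  qed
  then have "(THE s. P s = 1) = s0" using Ps0 by (rule the_equality[rotated])
  then show ?thesis using that[of x0 y0] x0 min by (simp add: s0_def)
qed

lemma above_is_minimum:
  assumes ge: "tA + tB \<le> min gA gB"
  shows "is_minimum {x + y | x y. h x y = 0 \<and> tA \<le> x \<and> x \<le> gB - tB} (THE s. P s = 1)"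
    and "is_minimum {x + y | x y. h x y = 0 \<and> tB \<le> y \<and> y \<le> gA - tA} (THE s. P s = 1)"
proof -
  obtain x0 y0 where x0: "(THE s. P s = 1) = x0 + y0" "h x0 y0 = 0" "tA \<le> x0" "tB \<le> y0"
    "\<And>x y. h x y = 0 \<Longrightarrow> tA \<le> x \<Longrightarrow> tB \<le> y \<Longrightarrow> x0 + y0 \<le> x + y"
    using root_above[OF ge] by blast
  show "is_minimum {x + y | x y. h x y = 0 \<and> tA \<le> x \<and> x \<le> gB - tB} (THE s. P s = 1)"
    "is_minimum {x + y | x y. h x y = 0 \<and> tB \<le> y \<and> y \<le> gA - tA} (THE s. P s = 1)"
    unfolding is_minimum_def x0(1) using x0(2-5) above_box by blast+
qed

text \<open>If the antidiagonal slope at the left end of the arc is nonnegative, the supporting plane there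
  keeps the whole arc on or above the line \<open>x + y = gA\<close>.\<close>

lemma above_left_end:
  assumes ge: "tA + tB \<le> min gA gB" and slope: "0 \<le> A tA (gA - tA) - B tA (gA - tA)"
  shows "(THE s. P s = 1) = gA"
proof -
  obtain x0 y0 where x0: "(THE s. P s = 1) = x0 + y0" "h x0 y0 = 0" "tA \<le> x0" "tB \<le> y0"
    "\<And>x y. h x y = 0 \<Longrightarrow> tA \<le> x \<Longrightarrow> tB \<le> y \<Longrightarrow> x0 + y0 \<le> x + y"
    using root_above[OF ge] by blast
  have "0 \<le> (x0 - tA) * (A tA (gA - tA) - B tA (gA - tA))" using x0 slope by simp
  then have "h x0 y0 \<le> h x0 (gA - x0)"
    using antidiagonal_support[of tA gA x0] gA_zero x0(2) by simp
  then have "gA \<le> x0 + y0" by (simp add: le_y_iff)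
  moreover have "x0 + y0 \<le> gA" using x0(5)[of tA "gA - tA"] gA_zero ge by simp
  ultimately show ?thesis using x0(1) by simp
qed

lemma above_right_end:
  assumes ge: "tA + tB \<le> min gA gB" and slope: "A (gB - tB) tB - B (gB - tB) tB \<le> 0"
  shows "(THE s. P s = 1) = gB"
proof -
  obtain x0 y0 where x0: "(THE s. P s = 1) = x0 + y0" "h x0 y0 = 0" "tA \<le> x0" "tB \<le> y0"
    "\<And>x y. h x y = 0 \<Longrightarrow> tA \<le> x \<Longrightarrow> tB \<le> y \<Longrightarrow> x0 + y0 \<le> x + y"
    using root_above[OF ge] by blast
  have "x0 \<le> gB - tB" using above_box(1)[OF x0(2)] x0(4) by simp
  then have "0 \<le> (x0 - (gB - tB)) * (A (gB - tB) tB - B (gB - tB) tB)"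
    using slope by (intro mult_nonpos_nonpos) auto
  then have "h x0 y0 \<le> h x0 (gB - x0)"
    using antidiagonal_support[of "gB - tB" gB x0] gB_zero x0(2) by simp
  then have "gB \<le> x0 + y0" by (simp add: le_y_iff)
  moreover have "x0 + y0 \<le> gB" using x0(5)[of "gB - tB" tB] gB_zero ge by simp
  ultimately show ?thesis using x0(1) by simp
qed

text \<open>The minimizer of \<open>x + y\<close> on the arc also minimizes \<open>h\<close> on the line \<open>x + y = s0\<close> over the same
  range of \<open>x\<close>. At an end of
  the arc the one-sided minimality would contradict the assumed sign of the slope, so the
  minimum is interior and the derivative vanishes there.\<close>

lemma above_interior:
  assumes ge: "tA + tB \<le> min gA gB" 
    and left: "A tA (gA - tA) - B tA (gA - tA) < 0" and right: "0 < A (gB - tB) tB - B (gB - tB) tB"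
  shows "\<exists>x\<in>{tA..gB - tB}. \<exists>y\<in>{tB..gA - tA}.
    h x y = 0 \<and> A x y - B x y = 0 \<and> (THE s. P s = 1) = x + y"
proof -
  obtain x0 y0 where x0: "(THE s. P s = 1) = x0 + y0" "h x0 y0 = 0" "tA \<le> x0" "tB \<le> y0"
    "\<And>x y. h x y = 0 \<Longrightarrow> tA \<le> x \<Longrightarrow> tB \<le> y \<Longrightarrow> x0 + y0 \<le> x + y"
    using root_above[OF ge] by blast
  define s0 where "s0 = x0 + y0"
  have box: "x0 \<le> gB - tB" "y0 \<le> gA - tA" using above_box[OF x0(2)] x0(3,4) by auto
  have min: "h x0 (s0 - x0) \<le> h x (s0 - x)" if x: "tA \<le> x" "x \<le> gB - tB" for x
  proof -
    obtain y where y: "h x y = 0" using ex1_zero_y by blast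
    then have "s0 - x \<le> y" using x0(5)[OF y x(1)] above_box(1)[OF y] x by (simp add: s0_def)
    then have "h x y \<le> h x (s0 - x)" by (simp add: le_y_iff)
    then show ?thesis using y x0(2) by (simp add: s0_def)
  qed
  have up: "0 \<le> A x0 y0 - B x0 y0" if "x0 < gB - tB"
    using antidiagonal_slope_nonneg[of x0 "gB - tB" s0] min that x0(3) by (simp add: s0_def)
  have down: "A x0 y0 - B x0 y0 \<le> 0" if "tA < x0"
    using antidiagonal_slope_nonpos[of tA x0 s0] min that box(1) by (simp add: s0_def)
  have atA: "y0 = gA - tA" if "x0 = tA" using that x0(2) gA_zero eq_y_iff[of tA y0 "gA - tA"] by simp
  have atB: "y0 = tB" if "x0 = gB - tB"
    using that x0(2) gB_zero eq_y_iff[of "gB - tB" y0 tB] by simp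
  have "A x0 y0 - B x0 y0 = 0"
  proof (cases "x0 = tA")
    case True
    then have "A x0 y0 - B x0 y0 < 0" using atA left by simp
    then show ?thesis using up atB right box(1) by fastforce
  next
    case False
    then have le: "A x0 y0 - B x0 y0 \<le> 0" using down x0(3) by simp
    then have "x0 \<noteq> gB - tB" using atB right by auto
    then show ?thesis using up le box(1) by simp
  qed
  then show ?thesis using x0 box by fastforce
qed

end

section \<open>The pressure of a diagonal graph-directed system\<close>

locale positive_diagonal_gifs =
  fixes G :: "('v::finite, 'e::finite) gifs" and p :: "'e \<Rightarrow> real" and q :: real
  assumes diagonal: "diagonal_box_like_gifs G"
    and connected: "strongly_connected G"
    and p_pos: "0 < p e"
begin

definition h :: "real \<Rightarrow> real \<Rightarrow> real" where
  "h x y = ln (spectral_radius (Fmat G p q x y))"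

definition A :: "real \<Rightarrow> real \<Rightarrow> real" where
  "A x y = (\<Sum>e\<in>UNIV. perron_weight (Fmat G p q x y) e * ln (acoef G e))"

definition B :: "real \<Rightarrow> real \<Rightarrow> real" where
  "B x y = (\<Sum>e\<in>UNIV. perron_weight (Fmat G p q x y) e * ln (bcoef G e))"

definition weight :: "real \<Rightarrow> real \<Rightarrow> 'e \<Rightarrow> real" where
  "weight x y e = p e powr q * acoef G e powr x * bcoef G e powr y"

lemma coef_bounds: "0 < acoef G e" "acoef G e < 1" "0 < bcoef G e" "bcoef G e < 1"
  using diagonal by (auto simp: diagonal_box_like_gifs_def)

lemma Fmat_eq_edge_matrix: "Fmat G p q x y = edge_matrix G (weight x y)"
  by (simp add: Fmat_def edge_matrix_def weight_def vec_eq_iff)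

lemma weight_exp: "weight x y e = exp (q * ln (p e) + x * ln (acoef G e) + y * ln (bcoef G e))"
  using p_pos[of e] coef_bounds[of e] by (simp add: weight_def powr_def exp_add)

lemma weight_pos: "0 < weight x y e"
  by (simp add: weight_exp)

lemma irreducible_Fmat: "irreducible_nonneg (Fmat G p q x y)"
  unfolding Fmat_eq_edge_matrix by (intro irreducible_nonneg_edge_matrix connected weight_pos)

lemma Fmat_shift:
  "Fmat G p q x' y' = scale_columns (Fmat G p q x y)
     (\<lambda>e. exp ((x' - x) * ln (acoef G e) + (y' - y) * ln (bcoef G e)))"
  by (simp add: Fmat_eq_edge_matrix edge_matrix_def scale_columns_def vec_eq_iff weight_exp
      algebra_simps flip: exp_add)

lemma h_eq_0_iff: "h x y = 0 \<longleftrightarrow> spectral_radius (Fmat G p q x y) = 1"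
  using spectral_radius_pos[OF irreducible_Fmat[of x y]] by (simp add: h_def)

text \<open>Moving \<open>(x, y)\<close> rescales the columns of \<open>F\<close>, so the support inequality and the derivative of
  the Perron root apply. The slopes are averages of \<open>ln a\<^sub>e\<close> and \<open>ln b\<^sub>e\<close>, and these are negative.\<close>

lemma is_pressure_plane: "\<exists>\<kappa> K. pressure_plane h A B \<kappa> K"
proof -
  define \<kappa> where "\<kappa> = Min (range (\<lambda>e. min (- ln (acoef G e)) (- ln (bcoef G e))))"
  define K where "K = Max (range (\<lambda>e. max (- ln (acoef G e)) (- ln (bcoef G e))))"
  have "min (- ln (acoef G e)) (- ln (bcoef G e)) > 0" for e
    using coef_bounds[of e] by simp
  then have \<kappa>: "0 < \<kappa>" by (auto simp: \<kappa>_def)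
  have le\<kappa>: "\<kappa> \<le> min (- ln (acoef G e)) (- ln (bcoef G e))" for e
    unfolding \<kappa>_def by (intro Min_le) auto
  have leK: "max (- ln (acoef G e)) (- ln (bcoef G e)) \<le> K" for e
    unfolding K_def by (intro Max_ge) auto
  have average: "- K \<le> (\<Sum>e\<in>UNIV. perron_weight (Fmat G p q x y) e * c e) \<and>
      (\<Sum>e\<in>UNIV. perron_weight (Fmat G p q x y) e * c e) \<le> - \<kappa>"
    if c: "\<And>e. - K \<le> c e" "\<And>e. c e \<le> - \<kappa>" for x y c
  proof -
    let ?\<pi> = "perron_weight (Fmat G p q x y)"
    have \<pi>: "0 \<le> ?\<pi> e" for e using perron_weight_pos[OF irreducible_Fmat] by (simp add: less_imp_le)
    have sum: "(\<Sum>e\<in>UNIV. ?\<pi> e * d) = d" for d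
      by (simp add: sum_perron_weight[OF irreducible_Fmat] flip: sum_distrib_right)
    have "(\<Sum>e\<in>UNIV. ?\<pi> e * - K) \<le> (\<Sum>e\<in>UNIV. ?\<pi> e * c e)"
      by (intro sum_mono mult_left_mono c \<pi>)
    moreover have "(\<Sum>e\<in>UNIV. ?\<pi> e * c e) \<le> (\<Sum>e\<in>UNIV. ?\<pi> e * - \<kappa>)"
      by (intro sum_mono mult_left_mono c \<pi>)
    ultimately show ?thesis unfolding sum by simp
  qed
  have "pressure_plane h A B \<kappa> K"
  proof
    fix x y x' y'
    have "h x y + (\<Sum>e\<in>UNIV. perron_weight (Fmat G p q x y) e *
          ((x' - x) * ln (acoef G e) + (y' - y) * ln (bcoef G e))) \<le> h x' y'"
      using ln_spectral_radius_support[OF irreducible_Fmat[of x y],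
          of "\<lambda>e. exp ((x' - x) * ln (acoef G e) + (y' - y) * ln (bcoef G e))"]
      unfolding h_def Fmat_shift[of x' y' x y] by simp
    then show "h x y + (x' - x) * A x y + (y' - y) * B x y \<le> h x' y'"
      by (simp add: A_def B_def distrib_left sum.distrib sum_distrib_left mult_ac)
  next
    fix x y
    show "- K \<le> A x y" "A x y \<le> - \<kappa>" "- K \<le> B x y" "B x y \<le> - \<kappa>"
      unfolding A_def B_def
      using average[of "\<lambda>e. ln (acoef G e)" x y] average[of "\<lambda>e. ln (bcoef G e)" x y] le\<kappa> leK
      by (simp_all add: minus_le_iff le_minus_iff)
    have "Fmat G p q (x + s) (y - s) = scale_columns (Fmat G p q x y)
        (\<lambda>e. exp (s * (ln (acoef G e) - ln (bcoef G e))))" for s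
      unfolding Fmat_shift[of "x + s" "y - s" x y] by (simp add: algebra_simps)
    then show "((\<lambda>s. h (x + s) (y - s)) has_real_derivative A x y - B x y) (at 0)"
      using ln_spectral_radius_scale_exp_derivative[OF irreducible_Fmat[of x y],
          of "\<lambda>e. ln (acoef G e) - ln (bcoef G e)"]
      by (simp add: h_def A_def B_def right_diff_distrib sum_subtractf)
  qed (rule \<kappa>)
  then show ?thesis by blast
qed

definition log_a :: "'e list \<Rightarrow> real" where "log_a w = ln (word_prod (acoef G) w)"
definition log_b :: "'e list \<Rightarrow> real" where "log_b w = ln (word_prod (bcoef G) w)"

lemma word_prod_coef_pos:
  "0 < word_prod (acoef G) w" "0 < word_prod (bcoef G) w" "0 < word_prod p w"
  by (auto intro!: word_prod_pos coef_bounds p_pos)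

lemma word_prod_weight:
  "word_prod (weight x y) w = exp (q * ln (word_prod p w) + x * log_a w + y * log_b w)"
proof (induction w)
  case (Cons e w)
  then show ?case
    using word_prod_coef_pos[of w] p_pos[of e] coef_bounds[of e]
    by (simp add: weight_exp log_a_def log_b_def ln_mult algebra_simps flip: exp_add)
qed (simp add: log_a_def log_b_def)

text \<open>Both branches are weights \<open>word_prod (weight x y)\<close> with \<open>x + y = s\<close>, at \<open>x = \<tau>\<^sub>A\<close> and at
  \<open>y = \<tau>\<^sub>B\<close>. The condition picks the larger one if \<open>s \<le> \<tau>\<^sub>A + \<tau>\<^sub>B\<close> and the smaller one if
  \<open>s \<ge> \<tau>\<^sub>A + \<tau>\<^sub>B\<close>.\<close>

lemma phi_exp:
  "phi G p \<mu> s q w = exp (q * ln (word_prod p w) +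
     (if log_b w \<le> log_a w then tauA \<mu> q * log_a w + (s - tauA \<mu> q) * log_b w
      else tauB \<mu> q * log_b w + (s - tauB \<mu> q) * log_a w))"
  using word_prod_coef_pos[of w]
  by (auto simp: phi_def alpha1_def alpha2_def tau_word_def log_a_def log_b_def powr_def exp_add
      max_def min_def)

lemma word_weight_growth:
  obtains c C where "0 < c" "0 < C"
    "\<And>k. 0 < k \<Longrightarrow> c * exp (real k * h x y) \<le> (\<Sum>w\<in>words G k. word_prod (weight x y) w)"
    "\<And>k. 0 < k \<Longrightarrow> (\<Sum>w\<in>words G k. word_prod (weight x y) w) \<le> C * exp (real k * h x y)"
proof -
  have "exp (real k * h x y) = spectral_radius (edge_matrix G (weight x y)) ^ k" for k
    using spectral_radius_pos[OF irreducible_Fmat[of x y]]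
    by (simp add: exp_of_nat_mult h_def Fmat_eq_edge_matrix)
  then show ?thesis
    using word_sum_growth[of G "weight x y", OF connected weight_pos] that by metis
qed

lemma pressure_norm_eq:
  "(\<Sum>v\<in>UNIV. \<Sum>v'\<in>UNIV. \<bar>pressure_matrix G p \<mu> s q k $ v $ v'\<bar>) = (\<Sum>w\<in>words G k. phi G p \<mu> s q w)"
proof -
  have pos: "0 \<le> phi G p \<mu> s q w" for w by (simp add: phi_exp)
  have "\<bar>pressure_matrix G p \<mu> s q k $ v $ v'\<bar> =
      (\<Sum>w\<in>words G k. if joins G v w v' then phi G p \<mu> s q w else 0)" for v v'
    by (simp add: pressure_matrix_def sum_nonneg pos sum.inter_filter finite_words)
  then have "(\<Sum>v\<in>UNIV. \<Sum>v'\<in>UNIV. \<bar>pressure_matrix G p \<mu> s q k $ v $ v'\<bar>) =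
     (\<Sum>v\<in>UNIV. \<Sum>v'\<in>UNIV. \<Sum>w\<in>words G k. if joins G v w v' then phi G p \<mu> s q w else 0)" by simp
  also have "\<dots> = (\<Sum>w\<in>words G k. \<Sum>v\<in>UNIV. \<Sum>v'\<in>UNIV. if joins G v w v' then phi G p \<mu> s q w else 0)"
    by (subst sum.swap, subst (2) sum.swap) (rule refl)
  also have "\<dots> = (\<Sum>w\<in>words G k. phi G p \<mu> s q w)"
  proof (rule sum.cong[OF refl])
    fix w
    have "(\<Sum>v'\<in>UNIV. if joins G v w v' then phi G p \<mu> s q w else 0) =
        (if ini G (hd w) = v then phi G p \<mu> s q w else 0)" for v
      by (cases "ini G (hd w) = v") (simp_all add: joins_def)
    then show "(\<Sum>v\<in>UNIV. \<Sum>v'\<in>UNIV. if joins G v w v' then phi G p \<mu> s q w else 0) = phi G p \<mu> s q w"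
      by simp
  qed
  finally show ?thesis .
qed

lemma pressure_eqI:
  assumes "\<And>k. 0 < k \<Longrightarrow> (\<Sum>w\<in>words G k. phi G p \<mu> s q w) \<le> C * exp (real k * H)"
    and "\<And>\<epsilon>::real. 0 < \<epsilon> \<Longrightarrow> \<exists>c>0. eventually
      (\<lambda>k. c * exp (real k * (H - \<epsilon>)) \<le> (\<Sum>w\<in>words G k. phi G p \<mu> s q w)) sequentially"
  shows "pressure G p \<mu> s q = exp H"
  unfolding pressure_def pressure_norm_eq
  by (rule limI) (rule root_tendsto_exp[OF assms])

text \<open>A maximum of two weights is at least each of them and at most their sum.\<close>

lemma pressure_below:
  assumes s: "s \<le> tauA \<mu> q + tauB \<mu> q"
  shows "pressure G p \<mu> s q =
    exp (max (h (tauA \<mu> q) (s - tauA \<mu> q)) (h (s - tauB \<mu> q) (tauB \<mu> q)))"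
proof -
  define tA tB where t: "tA = tauA \<mu> q" "tB = tauB \<mu> q"
  let ?H = "max (h tA (s - tA)) (h (s - tB) tB)"
  let ?W1 = "word_prod (weight tA (s - tA))" and ?W2 = "word_prod (weight (s - tB) tB)"
  have diff: "(tA * \<alpha> + (s - tA) * \<beta>) - (tB * \<beta> + (s - tB) * \<alpha>) = (tA + tB - s) * (\<alpha> - \<beta>)" for \<alpha> \<beta>
    by (simp add: algebra_simps)
  have ge: "?W1 w \<le> phi G p \<mu> s q w" "?W2 w \<le> phi G p \<mu> s q w" for w
  proof -
    have "(if log_b w \<le> log_a w then tA * log_a w + (s - tA) * log_b w
        else tB * log_b w + (s - tB) * log_a w)
      = max (tA * log_a w + (s - tA) * log_b w) (tB * log_b w + (s - tB) * log_a w)"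
    proof (cases "log_b w \<le> log_a w")
      case True
      then have "0 \<le> (tA + tB - s) * (log_a w - log_b w)"
        using s by (intro mult_nonneg_nonneg) (auto simp: t)
      then show ?thesis using diff[of "log_a w" "log_b w"] True unfolding max_def by auto
    next
      case False
      then have "(tA + tB - s) * (log_a w - log_b w) \<le> 0"
        using s by (intro mult_nonneg_nonpos) (auto simp: t)
      then show ?thesis using diff[of "log_a w" "log_b w"] False unfolding max_def by auto
    qed
    then show "?W1 w \<le> phi G p \<mu> s q w" "?W2 w \<le> phi G p \<mu> s q w"
      unfolding phi_exp word_prod_weight t[symmetric] by (simp_all add: max_def)
  qed
  have le: "phi G p \<mu> s q w \<le> ?W1 w + ?W2 w" for w
    unfolding phi_exp word_prod_weight t[symmetric] by (auto simp: algebra_simps)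
  obtain c1 C1 where c1: "0 < c1" "0 < C1"
    "\<And>k. 0 < k \<Longrightarrow> c1 * exp (real k * h tA (s - tA)) \<le> (\<Sum>w\<in>words G k. ?W1 w)"
    "\<And>k. 0 < k \<Longrightarrow> (\<Sum>w\<in>words G k. ?W1 w) \<le> C1 * exp (real k * h tA (s - tA))"
    by (rule word_weight_growth[of tA "s - tA"]) blast
  obtain c2 C2 where c2: "0 < c2" "0 < C2"
    "\<And>k. 0 < k \<Longrightarrow> c2 * exp (real k * h (s - tB) tB) \<le> (\<Sum>w\<in>words G k. ?W2 w)"
    "\<And>k. 0 < k \<Longrightarrow> (\<Sum>w\<in>words G k. ?W2 w) \<le> C2 * exp (real k * h (s - tB) tB)"
    by (rule word_weight_growth[of "s - tB" tB]) blast
  have "pressure G p \<mu> s q = exp ?H"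
  proof (rule pressure_eqI[where C = "C1 + C2"])
    fix k :: nat assume k: "0 < k"
    have "(\<Sum>w\<in>words G k. phi G p \<mu> s q w) \<le> (\<Sum>w\<in>words G k. ?W1 w) + (\<Sum>w\<in>words G k. ?W2 w)"
      unfolding sum.distrib[symmetric] by (intro sum_mono le)
    also have "\<dots> \<le> C1 * exp (real k * h tA (s - tA)) + C2 * exp (real k * h (s - tB) tB)"
      using c1(4)[OF k] c2(4)[OF k] by simp
    also have "\<dots> \<le> C1 * exp (real k * ?H) + C2 * exp (real k * ?H)"
      using c1(2) c2(2) by (intro add_mono mult_left_mono) (auto intro!: mult_left_mono)
    finally show "(\<Sum>w\<in>words G k. phi G p \<mu> s q w) \<le> (C1 + C2) * exp (real k * ?H)"
      by (simp add: distrib_right)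
  next
    fix \<epsilon> :: real assume \<epsilon>: "0 < \<epsilon>"
    have "min c1 c2 * exp (real k * (?H - \<epsilon>)) \<le> (\<Sum>w\<in>words G k. phi G p \<mu> s q w)" if k: "0 < k" for k
    proof -
      have "min c1 c2 * exp (real k * (?H - \<epsilon>)) \<le> min c1 c2 * exp (real k * ?H)"
        using \<epsilon> c1(1) c2(1) by (intro mult_left_mono) (auto intro!: mult_left_mono)
      also have "\<dots> \<le> max (c1 * exp (real k * h tA (s - tA))) (c2 * exp (real k * h (s - tB) tB))"
      proof (cases "h (s - tB) tB \<le> h tA (s - tA)")
        case True
        then have "?H = h tA (s - tA)" by simp
        then show ?thesis by (intro max.coboundedI1) (auto intro!: mult_right_mono)
      next
        case False
        then have "?H = h (s - tB) tB" by simp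
        then show ?thesis by (intro max.coboundedI2) (auto intro!: mult_right_mono)
      qed
      also have "\<dots> \<le> max (\<Sum>w\<in>words G k. ?W1 w) (\<Sum>w\<in>words G k. ?W2 w)"
        by (intro max.mono c1(3) c2(3) k)
      also have "\<dots> \<le> (\<Sum>w\<in>words G k. phi G p \<mu> s q w)"
        by (intro max.boundedI sum_mono ge)
      finally show ?thesis .
    qed
    then show "\<exists>c>0. eventually
        (\<lambda>k. c * exp (real k * (?H - \<epsilon>)) \<le> (\<Sum>w\<in>words G k. phi G p \<mu> s q w)) sequentially"
      using c1(1) c2(1)
      by (intro exI[of _ "min c1 c2"] conjI eventually_mono[OF eventually_gt_at_top[of 0]]) auto
  qed
  then show ?thesis by (simp add: t)
qed

text \<open>Exponential tilting. If the derivative of \<open>h\<close> along the antidiagonal towards the side \<open>\<sigma>\<close> is not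
  positive, then moving a distance \<open>\<eta>\<close> to that side raises \<open>h\<close> by at most \<open>\<eta> \<delta> / 2\<close> for some small
  \<open>\<eta>\<close>, but raises the weight of a word with \<open>\<sigma> ln (a\<^sub>w / b\<^sub>w) > k \<delta>\<close> by at least the factor \<open>exp (\<eta> \<delta> k)\<close>. Such
  words therefore carry an exponentially small part of the total weight.\<close>

lemma tilted_tail:
  assumes \<sigma>: "\<sigma> = 1 \<or> \<sigma> = -1" and slope: "\<sigma> * (A x y - B x y) \<le> 0" and \<delta>: "0 < \<delta>"
  shows "\<exists>\<theta> C. 0 < \<theta> \<and> (\<forall>k>0.
    (\<Sum>w\<in>{w\<in>words G k. real k * \<delta> < \<sigma> * (log_a w - log_b w)}. word_prod (weight x y) w)
      \<le> C * exp (real k * (h x y - \<theta>)))"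
proof -
  obtain \<kappa> K where "pressure_plane h A B \<kappa> K" using is_pressure_plane by blast
  then interpret pressure_plane h A B \<kappa> K .
  have "((\<lambda>s. h (x + s) (y - s)) has_real_derivative (A x y - B x y)) (at (\<sigma> * 0))"
    using derivative by simp
  moreover have "((\<lambda>s. \<sigma> * s) has_real_derivative \<sigma>) (at 0)"
    by (auto intro!: derivative_eq_intros)
  ultimately have "((\<lambda>s. h (x + \<sigma> * s) (y - \<sigma> * s)) has_real_derivative (A x y - B x y) * \<sigma>) (at 0)"
    by (rule DERIV_chain2)
  moreover have "((\<lambda>s. s * (\<delta> / 2)) has_real_derivative \<delta> / 2) (at 0)"
    by (auto intro!: derivative_eq_intros)
  ultimately have "((\<lambda>s. h (x + \<sigma> * s) (y - \<sigma> * s) - s * (\<delta> / 2)) has_real_derivative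
      (A x y - B x y) * \<sigma> - \<delta> / 2) (at 0)"
    by (rule DERIV_diff)
  moreover have "(A x y - B x y) * \<sigma> - \<delta> / 2 < 0" using slope \<delta> by (simp add: mult.commute)
  ultimately have "\<exists>d>0. \<forall>e>0. e < d \<longrightarrow>
      h (x + \<sigma> * (0 + e)) (y - \<sigma> * (0 + e)) - (0 + e) * (\<delta> / 2) <
      h (x + \<sigma> * 0) (y - \<sigma> * 0) - 0 * (\<delta> / 2)"
    by (rule DERIV_neg_dec_right)
  then obtain d where d: "0 < d"
    "\<And>e. 0 < e \<Longrightarrow> e < d \<Longrightarrow> h (x + \<sigma> * e) (y - \<sigma> * e) - e * (\<delta> / 2) < h x y"
    by auto
  define \<eta> where "\<eta> = d / 2"
  have \<eta>: "0 < \<eta>" "h (x + \<sigma> * \<eta>) (y - \<sigma> * \<eta>) \<le> h x y + \<eta> * \<delta> / 2"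
    using d(1) d(2)[of "d / 2"] by (auto simp: \<eta>_def)
  obtain C where C: "0 < C"
    "\<And>k. 0 < k \<Longrightarrow> (\<Sum>w\<in>words G k. word_prod (weight (x + \<sigma> * \<eta>) (y - \<sigma> * \<eta>)) w)
       \<le> C * exp (real k * h (x + \<sigma> * \<eta>) (y - \<sigma> * \<eta>))"
    by (rule word_weight_growth[of "x + \<sigma> * \<eta>" "y - \<sigma> * \<eta>"]) blast
  show ?thesis
  proof (intro exI conjI allI impI)
    show "0 < \<eta> * \<delta> / 2" using \<eta>(1) \<delta> by simp
    fix k :: nat assume k: "0 < k"
    let ?bad = "{w\<in>words G k. real k * \<delta> < \<sigma> * (log_a w - log_b w)}"
    let ?W = "word_prod (weight (x + \<sigma> * \<eta>) (y - \<sigma> * \<eta>))"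
    have "word_prod (weight x y) w \<le> exp (- (\<eta> * (real k * \<delta>))) * ?W w" if "w \<in> ?bad" for w
    proof -
      have "\<eta> * (real k * \<delta>) \<le> \<eta> * (\<sigma> * (log_a w - log_b w))"
        using that \<eta>(1) by (intro mult_left_mono) auto
      then show ?thesis
        unfolding word_prod_weight by (simp add: algebra_simps flip: exp_add)
    qed
    then have "(\<Sum>w\<in>?bad. word_prod (weight x y) w) \<le> (\<Sum>w\<in>?bad. exp (- (\<eta> * (real k * \<delta>))) * ?W w)"
      by (rule sum_mono)
    also have "\<dots> \<le> (\<Sum>w\<in>words G k. exp (- (\<eta> * (real k * \<delta>))) * ?W w)"
      by (intro sum_mono2 finite_words) (auto simp: word_prod_weight)
    also have "\<dots> \<le> exp (- (\<eta> * (real k * \<delta>))) * (C * exp (real k * h (x + \<sigma> * \<eta>) (y - \<sigma> * \<eta>)))"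
      unfolding sum_distrib_left[symmetric] by (intro mult_left_mono C(2) k) auto
    also have "\<dots> \<le> exp (- (\<eta> * (real k * \<delta>))) * (C * exp (real k * (h x y + \<eta> * \<delta> / 2)))"
      using \<eta>(2) C(1) by (intro mult_left_mono) (auto intro!: mult_left_mono)
    also have "\<dots> = C * exp (real k * (h x y - \<eta> * \<delta> / 2))"
      by (simp add: algebra_simps flip: exp_add)
    finally show "(\<Sum>w\<in>?bad. word_prod (weight x y) w) \<le> C * exp (real k * (h x y - \<eta> * \<delta> / 2))" .
  qed
qed

text \<open>Now \<open>\<phi>\<close> is the minimum of the two end weights, hence at most the weight at every point of the
  segment; this bounds the pressure by the minimum of \<open>exp h\<close>. For the converse, the weight at the
  minimizer is concentrated, by the tail estimates, on words with
  \<open>ln (a\<^sub>w / b\<^sub>w) \<le> k \<delta>\<close> if the segment extends to the left of the minimizer, and with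
  \<open>ln (b\<^sub>w / a\<^sub>w) \<le> k \<delta>\<close> if it extends to the right. On those words \<open>\<phi>\<close> is at least
  \<open>exp (- k \<epsilon>)\<close> times that weight.\<close>

lemma pressure_above:
  assumes s: "tauA \<mu> q + tauB \<mu> q \<le> s" and x0: "x0 \<in> {tauA \<mu> q..s - tauB \<mu> q}"
    and min: "\<And>x. x \<in> {tauA \<mu> q..s - tauB \<mu> q} \<Longrightarrow> h x0 (s - x0) \<le> h x (s - x)"
  shows "pressure G p \<mu> s q = exp (h x0 (s - x0))"
proof -
  obtain \<kappa> K where "pressure_plane h A B \<kappa> K" using is_pressure_plane by blast
  then interpret pressure_plane h A B \<kappa> K .
  define tA tB where t: "tA = tauA \<mu> q" "tB = tauB \<mu> q"
  let ?W = "word_prod (weight x0 (s - x0))" and ?H = "h x0 (s - x0)"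
  have diff: "(tA * \<alpha> + (s - tA) * \<beta>) - (x0 * \<alpha> + (s - x0) * \<beta>) = - ((x0 - tA) * (\<alpha> - \<beta>))"
    "(tB * \<beta> + (s - tB) * \<alpha>) - (x0 * \<alpha> + (s - x0) * \<beta>) = - ((s - tB - x0) * (\<beta> - \<alpha>))" for \<alpha> \<beta>
    by (simp_all add: algebra_simps)
  have x0': "tA \<le> x0" "x0 \<le> s - tB" using x0 by (auto simp: t)
  have le: "phi G p \<mu> s q w \<le> ?W w" for w
  proof (cases "log_b w \<le> log_a w")
    case True
    then have "0 \<le> (x0 - tA) * (log_a w - log_b w)" using x0' by (intro mult_nonneg_nonneg) auto
    then have "tA * log_a w + (s - tA) * log_b w \<le> x0 * log_a w + (s - x0) * log_b w"
      using diff(1)[of "log_a w" "log_b w"] by linarith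
    then show ?thesis unfolding phi_exp word_prod_weight t[symmetric] using True by simp
  next
    case False
    then have "0 \<le> (s - tB - x0) * (log_b w - log_a w)" using x0' by (intro mult_nonneg_nonneg) auto
    then have "tB * log_b w + (s - tB) * log_a w \<le> x0 * log_a w + (s - x0) * log_b w"
      using diff(2)[of "log_b w" "log_a w"] by linarith
    then show ?thesis unfolding phi_exp word_prod_weight t[symmetric] using False by simp
  qed
  obtain c C where c: "0 < c" "0 < C"
    "\<And>k. 0 < k \<Longrightarrow> c * exp (real k * ?H) \<le> (\<Sum>w\<in>words G k. ?W w)"
    "\<And>k. 0 < k \<Longrightarrow> (\<Sum>w\<in>words G k. ?W w) \<le> C * exp (real k * ?H)"
    by (rule word_weight_growth[of x0 "s - x0"]) blast
  have "pressure G p \<mu> s q = exp ?H"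
  proof (rule pressure_eqI[where C = C])
    fix k :: nat assume k: "0 < k"
    show "(\<Sum>w\<in>words G k. phi G p \<mu> s q w) \<le> C * exp (real k * ?H)"
      using sum_mono[of "words G k", OF le] c(4)[OF k] by (rule order.trans)
  next
    fix \<epsilon> :: real assume \<epsilon>: "0 < \<epsilon>"
    (* The length D of the segment bounds the distance of the minimizer to both ends.
       Adding 1 keeps the denominator positive when the segment is a single point. *)
    define D where "D = s - tA - tB"
    have D: "0 \<le> D" using s by (simp add: D_def t)
    define \<delta> where "\<delta> = \<epsilon> / (D + 1)"
    have \<delta>: "0 < \<delta>" "D * \<delta> \<le> \<epsilon>" using D \<epsilon> by (auto simp: \<delta>_def field_simps)
    (* If the minimizer is an end of the segment, one of the two inequalities for
       ln (a_w / b_w) is neither available nor required, and its exceptional set is empty. *)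
    define bad1 where "bad1 k = {w\<in>words G k. tA < x0 \<and> real k * \<delta> < 1 * (log_a w - log_b w)}" for k
    define bad2 where "bad2 k = {w\<in>words G k. x0 < s - tB \<and> real k * \<delta> < -1 * (log_a w - log_b w)}" for k
    have "\<exists>\<theta> C. 0 < \<theta> \<and> (\<forall>k>0. (\<Sum>w\<in>bad1 k. ?W w) \<le> C * exp (real k * (?H - \<theta>)))"
    proof (cases "tA < x0")
      case True
      have "A x0 (s - x0) - B x0 (s - x0) \<le> 0"
        using antidiagonal_slope_nonpos[OF True, of s] min x0' by (simp add: t)
      moreover have "bad1 k = {w\<in>words G k. real k * \<delta> < 1 * (log_a w - log_b w)}" for k
        using True by (simp add: bad1_def)
      ultimately show ?thesis
        using tilted_tail[of 1 x0 "s - x0" \<delta>] \<delta>(1) by simp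
    next
      case False
      then have "(\<Sum>w\<in>bad1 k. ?W w) \<le> 0 * exp (real k * (?H - 1))" for k
        by (simp add: bad1_def)
      then show ?thesis by (intro exI[of _ 1] exI[of _ 0]) simp
    qed
    then obtain \<theta>1 C1 where bad1: "0 < \<theta>1" "\<And>k. 0 < k \<Longrightarrow> (\<Sum>w\<in>bad1 k. ?W w) \<le> C1 * exp (real k * (?H - \<theta>1))"
      by blast
    have "\<exists>\<theta> C. 0 < \<theta> \<and> (\<forall>k>0. (\<Sum>w\<in>bad2 k. ?W w) \<le> C * exp (real k * (?H - \<theta>)))"
    proof (cases "x0 < s - tB")
      case True
      have "0 \<le> A x0 (s - x0) - B x0 (s - x0)"
        using antidiagonal_slope_nonneg[OF True, of s] min x0' by (simp add: t)
      moreover have "bad2 k = {w\<in>words G k. real k * \<delta> < -1 * (log_a w - log_b w)}" for k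
        using True by (simp add: bad2_def)
      ultimately show ?thesis
        using tilted_tail[of "-1" x0 "s - x0" \<delta>] \<delta>(1) by simp
    next
      case False
      then have "(\<Sum>w\<in>bad2 k. ?W w) \<le> 0 * exp (real k * (?H - 1))" for k
        by (simp add: bad2_def)
      then show ?thesis by (intro exI[of _ 1] exI[of _ 0]) simp
    qed
    then obtain \<theta>2 C2 where bad2: "0 < \<theta>2" "\<And>k. 0 < k \<Longrightarrow> (\<Sum>w\<in>bad2 k. ?W w) \<le> C2 * exp (real k * (?H - \<theta>2))"
      by blast
    (* With c / 4 for each of the two exceptional sets, half of the lower bound c remains. *)
    have decay: "eventually (\<lambda>k. C' * exp (real k * (?H - \<theta>)) \<le> c / 4 * exp (real k * ?H)) sequentially"
      if "0 < \<theta>" for C' \<theta>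
    proof -
      have "(\<lambda>k. C' * exp (- \<theta>) ^ k) \<longlonglongrightarrow> C' * 0"
        using that by (intro tendsto_intros LIMSEQ_power_zero) auto
      then have "eventually (\<lambda>k. C' * exp (- \<theta>) ^ k < c / 4) sequentially"
        using c(1) by (intro order_tendstoD(2)) auto
      then show ?thesis
      proof eventually_elim
        case (elim k)
        have eq: "C' * exp (real k * (?H - \<theta>)) = C' * exp (- \<theta>) ^ k * exp (real k * ?H)"
          by (simp add: algebra_simps flip: exp_of_nat_mult exp_add)
        show ?case unfolding eq using elim by (intro mult_right_mono) auto
      qed
    qed
    have "eventually (\<lambda>k. c / 2 * exp (real k * (?H - \<epsilon>)) \<le> (\<Sum>w\<in>words G k. phi G p \<mu> s q w)) sequentially"
      using decay[OF bad1(1), of C1] decay[OF bad2(1), of C2] eventually_gt_at_top[of 0]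
    proof eventually_elim
      case (elim k)
      let ?good = "words G k - (bad1 k \<union> bad2 k)"
      have "c * exp (real k * ?H) \<le> (\<Sum>w\<in>words G k. ?W w)" by (rule c(3)[OF elim(3)])
      also have "\<dots> = (\<Sum>w\<in>?good. ?W w) + (\<Sum>w\<in>bad1 k \<union> bad2 k. ?W w)"
        by (intro sum.subset_diff finite_words) (auto simp: bad1_def bad2_def)
      also have "(\<Sum>w\<in>bad1 k \<union> bad2 k. ?W w) \<le> (\<Sum>w\<in>bad1 k. ?W w) + (\<Sum>w\<in>bad2 k. ?W w)"
      proof -
        have fin: "finite (bad1 k)" "finite (bad2 k)" by (auto simp: bad1_def bad2_def finite_words)
        have "0 \<le> (\<Sum>w\<in>bad1 k \<inter> bad2 k. ?W w)" by (intro sum_nonneg) (simp add: word_prod_weight)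
        then show ?thesis using sum.union_inter[OF fin, of ?W] by linarith
      qed
      also have "\<dots> \<le> c / 4 * exp (real k * ?H) + c / 4 * exp (real k * ?H)"
        using bad1(2)[OF elim(3)] bad2(2)[OF elim(3)] elim(1,2) by linarith
      finally have "c / 2 * exp (real k * ?H) \<le> (\<Sum>w\<in>?good. ?W w)" by simp
      then have "exp (- (real k * \<epsilon>)) * (c / 2 * exp (real k * ?H)) \<le> exp (- (real k * \<epsilon>)) * (\<Sum>w\<in>?good. ?W w)"
        by (rule mult_left_mono) simp
      moreover have "exp (- (real k * \<epsilon>)) * (c / 2 * exp (real k * ?H)) = c / 2 * exp (real k * (?H - \<epsilon>))"
        by (simp add: algebra_simps flip: exp_add)
      moreover have "exp (- (real k * \<epsilon>)) * (\<Sum>w\<in>?good. ?W w) \<le> (\<Sum>w\<in>?good. phi G p \<mu> s q w)"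
        unfolding sum_distrib_left
      proof (rule sum_mono)
        fix w assume w: "w \<in> ?good"
        let ?d = "log_a w - log_b w"
        have bound: "r * z \<le> real k * \<epsilon>" if "0 \<le> r" "r \<le> D" "0 < r \<Longrightarrow> z \<le> real k * \<delta>" for r z
        proof (cases "r = 0")
          case True
          then show ?thesis using \<epsilon> by simp
        next
          case False
          then have "r * z \<le> r * (real k * \<delta>)" using that by (intro mult_left_mono) auto
          also have "\<dots> \<le> D * (real k * \<delta>)" using that \<delta>(1) by (intro mult_right_mono) auto
          also have "\<dots> \<le> real k * \<epsilon>" using mult_left_mono[OF \<delta>(2), of "real k"] by (simp add: mult_ac)
          finally show ?thesis .
        qed
        have "(x0 - tA) * ?d \<le> real k * \<epsilon>"
          using w x0' by (intro bound) (auto simp: bad1_def D_def)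
        moreover have "(s - tB - x0) * (log_b w - log_a w) \<le> real k * \<epsilon>"
          using w x0' by (intro bound) (auto simp: bad2_def D_def)
        ultimately have
          "- (real k * \<epsilon>) + (x0 * log_a w + (s - x0) * log_b w) \<le> tA * log_a w + (s - tA) * log_b w"
          "- (real k * \<epsilon>) + (x0 * log_a w + (s - x0) * log_b w) \<le> tB * log_b w + (s - tB) * log_a w"
          using diff(1)[of "log_a w" "log_b w"] diff(2)[of "log_b w" "log_a w"] by linarith+
        then show "exp (- (real k * \<epsilon>)) * ?W w \<le> phi G p \<mu> s q w"
          unfolding phi_exp word_prod_weight t[symmetric] exp_add[symmetric] by auto
      qed
      moreover have "(\<Sum>w\<in>?good. phi G p \<mu> s q w) \<le> (\<Sum>w\<in>words G k. phi G p \<mu> s q w)"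
        by (intro sum_mono2 finite_words) (auto simp: phi_exp)
      ultimately show ?case by linarith
    qed
    then show "\<exists>c>0. eventually
        (\<lambda>k. c * exp (real k * (?H - \<epsilon>)) \<le> (\<Sum>w\<in>words G k. phi G p \<mu> s q w)) sequentially"
      using c(1) by (intro exI[of _ "c / 2"]) auto
  qed
  then show ?thesis .
qed

end

section \<open>The value of the pressure root\<close>

context positive_diagonal_gifs
begin

lemma h_gammaA: "h (tauA \<mu> q) (gammaA G p \<mu> q - tauA \<mu> q) = 0"
proof -
  obtain \<kappa> K where "pressure_plane h A B \<kappa> K" using is_pressure_plane by blast
  then interpret pressure_plane h A B \<kappa> K .
  obtain y where "h (tauA \<mu> q) y = 0" using ex1_zero_y by blast
  then have "\<exists>!g. h (tauA \<mu> q) (g - tauA \<mu> q) = 0"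
    using eq_y_iff by (intro ex1I[of _ "tauA \<mu> q + y"]) (simp, metis add_diff_cancel_left' diff_add_cancel add.commute)
  then show ?thesis unfolding gammaA_def h_eq_0_iff[symmetric] by (rule theI')
qed

lemma h_gammaB: "h (gammaB G p \<mu> q - tauB \<mu> q) (tauB \<mu> q) = 0"
proof -
  obtain \<kappa> K where "pressure_plane h A B \<kappa> K" using is_pressure_plane by blast
  then interpret pressure_plane h A B \<kappa> K .
  obtain x where "h x (tauB \<mu> q) = 0" using ex1_zero_x by blast
  then have "\<exists>!g. h (g - tauB \<mu> q) (tauB \<mu> q) = 0"
    using eq_x_iff by (intro ex1I[of _ "x + tauB \<mu> q"]) (simp, metis diff_add_cancel)
  then show ?thesis unfolding gammaB_def h_eq_0_iff[symmetric] by (rule theI')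
qed

text \<open>On the curve \<open>\<rho> = 1\<close> the weights \<open>f\<^sub>e\<close> are the Perron weights of \<open>F\<close>, so the sum in the statement is
  the derivative of \<open>ln \<rho>\<close> in the direction \<open>(1, -1)\<close>.\<close>

lemma sum_f_weight:
  assumes "h x y = 0"
  shows "(\<Sum>e\<in>UNIV. f_weight G p q e x * ln (acoef G e / bcoef G e)) = A x y - B x y"
proof -
  obtain \<kappa> K where "pressure_plane h A B \<kappa> K" using is_pressure_plane by blast
  then interpret pressure_plane h A B \<kappa> K .
  have "y_of G p q x = y"
    unfolding y_of_def h_eq_0_iff[symmetric] using assms ex1_zero_y[of x] by (intro the1_equality)
  then have "f_weight G p q e x = perron_weight (Fmat G p q x y) e" for e
    using assms unfolding h_eq_0_iff by (simp add: f_weight_def perron_weight_def)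
  moreover have "ln (acoef G e / bcoef G e) = ln (acoef G e) - ln (bcoef G e)" for e
    using coef_bounds[of e] by (simp add: ln_div)
  ultimately show ?thesis by (simp add: A_def B_def right_diff_distrib sum_subtractf)
qed

end

theorem theorem2p3:
  fixes G :: "('v::finite, 'e::finite) gifs"
    and p :: "'e \<Rightarrow> real"
    and X :: "'v \<Rightarrow> (real^2) set"
    and \<mu> :: "'v \<Rightarrow> (real^2) measure"
    and q tA tB t gA gB :: real
    and \<rho> :: "real \<Rightarrow> real \<Rightarrow> real"
    and L :: "real \<Rightarrow> real"
  assumes gifs: "diagonal_box_like_gifs G"
    and sc: "strongly_connected G"
    and rosc: "ROSC G"
    and p: "associated_positive_vector G p"
    and X: "attractor_family G X"
    and mu: "associated_measure_family G p X \<mu>"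
    and q: "q \<ge> 0"
    and tA: "tA = tauA \<mu> q"
    and tB: "tB = tauB \<mu> q"
    and t: "t = tA + tB"
    and gA: "gA = gammaA G p \<mu> q"
    and gB: "gB = gammaB G p \<mu> q"
    and rho: "\<rho> = (\<lambda>x y. spectral_radius (Fmat G p q x y))"
    and L: "L = (\<lambda>x. \<Sum>e\<in>UNIV. f_weight G p q e x * ln (acoef G e / bcoef G e))"
  shows "(max gA gB \<le> t \<or> min gA gB \<ge> t) \<and>
    (max gA gB \<le> t \<longrightarrow>
       gamma G p \<mu> q = max gA gB \<and>
       is_maximum {x + y | x y. \<rho> x y = 1 \<and> gB - tB \<le> x \<and> x \<le> tA} (gamma G p \<mu> q) \<and>
       is_maximum {x + y | x y. \<rho> x y = 1 \<and> gA - tA \<le> y \<and> y \<le> tB} (gamma G p \<mu> q)) \<and>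
    (min gA gB \<ge> t \<longrightarrow>
       is_minimum {x + y | x y. \<rho> x y = 1 \<and> tA \<le> x \<and> x \<le> gB - tB} (gamma G p \<mu> q) \<and>
       is_minimum {x + y | x y. \<rho> x y = 1 \<and> tB \<le> y \<and> y \<le> gA - tA} (gamma G p \<mu> q) \<and>
       (L tA \<ge> 0 \<longrightarrow> gamma G p \<mu> q = gA) \<and>
       (L (gB - tB) \<le> 0 \<longrightarrow> gamma G p \<mu> q = gB) \<and>
       (\<not> L tA \<ge> 0 \<and> \<not> L (gB - tB) \<le> 0 \<longrightarrow>
          (\<exists>x\<in>{tA..gB - tB}. \<exists>y\<in>{tB..gA - tA}.
             \<rho> x y = 1 \<and> L x = 0 \<and> gamma G p \<mu> q = x + y)))"
proof -
  interpret positive_diagonal_gifs G p q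
    using gifs sc p by unfold_locales (auto simp: associated_positive_vector_def)
  obtain \<kappa> K where "pressure_plane h A B \<kappa> K" using is_pressure_plane by blast
  then interpret pressure_plane h A B \<kappa> K .
  interpret pressure_equation h A B \<kappa> K tA tB gA gB "\<lambda>s. pressure G p \<mu> s q"
    unfolding tA tB gA gB
    by unfold_locales (use h_gammaA h_gammaB pressure_below pressure_above in \<open>blast+\<close>)
  have \<rho>: "\<rho> x y = 1 \<longleftrightarrow> h x y = 0" for x y by (simp add: rho h_eq_0_iff)
  have slope: "L x = A x y - B x y" if "h x y = 0" for x y
    unfolding L by (rule sum_f_weight[OF that])
  have slope_A: "L tA = A tA (gA - tA) - B tA (gA - tA)"
    and slope_B: "L (gB - tB) = A (gB - tB) tB - B (gB - tB) tB"
    by (rule slope, rule gA_zero) (rule slope, rule gB_zero)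
  show ?thesis
    unfolding t gamma_def \<rho>
  proof (intro conjI impI)
    show "max gA gB \<le> tA + tB \<or> tA + tB \<le> min gA gB" by (rule dichotomy)
  next
    assume le: "max gA gB \<le> tA + tB"
    show root: "(THE s. pressure G p \<mu> s q = 1) = max gA gB" by (rule root_below[OF le])
    show "is_maximum {x + y | x y. h x y = 0 \<and> gB - tB \<le> x \<and> x \<le> tA} (THE s. pressure G p \<mu> s q = 1)"
      "is_maximum {x + y | x y. h x y = 0 \<and> gA - tA \<le> y \<and> y \<le> tB} (THE s. pressure G p \<mu> s q = 1)"
      unfolding root by (rule below_is_maximum[OF le])+
  next
    assume ge: "tA + tB \<le> min gA gB"
    show "is_minimum {x + y | x y. h x y = 0 \<and> tA \<le> x \<and> x \<le> gB - tB} (THE s. pressure G p \<mu> s q = 1)"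
      "is_minimum {x + y | x y. h x y = 0 \<and> tB \<le> y \<and> y \<le> gA - tA} (THE s. pressure G p \<mu> s q = 1)"
      by (rule above_is_minimum[OF ge])+
    show "(THE s. pressure G p \<mu> s q = 1) = gA" if "0 \<le> L tA"
      using above_left_end[OF ge] that by (simp add: slope_A)
    show "(THE s. pressure G p \<mu> s q = 1) = gB" if "L (gB - tB) \<le> 0"
      using above_right_end[OF ge] that by (simp add: slope_B)
    show "\<exists>x\<in>{tA..gB - tB}. \<exists>y\<in>{tB..gA - tA}. h x y = 0 \<and> L x = 0 \<and>
        (THE s. pressure G p \<mu> s q = 1) = x + y"
      if "\<not> 0 \<le> L tA \<and> \<not> L (gB - tB) \<le> 0"
      using above_interior[OF ge] that unfolding slope_A slope_B not_le using slope by metis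
  qed
qed

end
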